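(* Let $c>0$ and $\theta<0$ be real numbers, and let $\varepsilon>0$ be arbitrary. Then $$\mathrm{E}(z;c,\theta) = -K_1 (\log z)^{\frac{\theta}{2(1-\theta)}}\exp\left(K_2 (\log z)^{\frac{\theta}{\theta-1}}\right)\left(1+\mathrm{O}\left((\log z)^{-\mu}\right)\right)$$ as $z\to\infty$ in an arbitrary sector with vertex at zero that does not contain the negative real axis. The positive constants $K_1,K_2$ are $$K_1=(2\pi(1-\theta))^{-1/2}(-c\theta)^{\frac{1}{2(\theta-1)}},\qquad K_2=\left(1-\tfrac{1}{\theta}\right)(-c\theta)^{\frac{1}{1-\theta}},$$ and the exponent $\mu$ is $$\mu=\begin{cases}\frac{\theta}{2(\theta-1)}-\varepsilon, & \theta\ge -2,\\[2pt] \frac{1}{1-\theta}, & \theta<-2.\end{cases}$$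
   Context: For $c\in\mathbb{R}$ and $\theta<0$, $\mathrm{E}(z;c,\theta)=\sum_{n=1}^\infty \mathrm{e}^{c n^\theta}(-z)^n$ for $|z|<1$, and $\mathrm{E}(z;c,\theta)$ also denotes the analytic continuation of this function to $\mathbb{C}\setminus(-\infty,-1]$. The logarithm and powers are principal branches. *)

theory Defs
  imports "HOL-Complex_Analysis.Complex_Analysis" "HOL-Library.Landau_Symbols"
begin

definition E_series :: "real \<Rightarrow> real \<Rightarrow> complex \<Rightarrow> complex" where
  "E_series c \<theta> z =
     (\<Sum>n. of_real (exp (c * real (Suc n) powr \<theta>)) * (- z) ^ Suc n)"

definition slit_plane :: "complex set" where
  "slit_plane = - (complex_of_real ` {..- 1})"

text \<open>The slit plane is connected and contains the unit disc, so at most one function on it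
  satisfies the condition below; the values on the slit itself are unspecified. That such a function
  exists is not built into the definition: it has to be proved before anything can be said about
  \<^term>\<open>E_fun\<close>.\<close>

definition E_fun :: "real \<Rightarrow> real \<Rightarrow> complex \<Rightarrow> complex" where
  "E_fun c \<theta> =
     (SOME f. f holomorphic_on slit_plane \<and> (\<forall>z\<in>ball 0 1. f z = E_series c \<theta> z))"

text \<open>Sectors are closed: an open sector with the negative real axis as a boundary ray is not covered,
  so the asymptotics is not claimed uniformly up to the cut.\<close>

definition sector :: "real \<Rightarrow> real \<Rightarrow> complex set" where
  "sector \<alpha> \<beta> = {rcis r \<phi> | r \<phi>. 0 \<le> r \<and> \<alpha> \<le> \<phi> \<and> \<phi> \<le> \<beta>}"

definition K1 :: "real \<Rightarrow> real \<Rightarrow> real" where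
  "K1 c \<theta> = (2 * pi * (1 - \<theta>)) powr (- 1 / 2) * (- c * \<theta>) powr (1 / (2 * (\<theta> - 1)))"

definition K2 :: "real \<Rightarrow> real \<Rightarrow> real" where
  "K2 c \<theta> = (1 - 1 / \<theta>) * (- c * \<theta>) powr (1 / (1 - \<theta>))"

definition mu :: "real \<Rightarrow> real \<Rightarrow> real" where
  "mu \<theta> \<epsilon> = (if \<theta> \<ge> - 2 then \<theta> / (2 * (\<theta> - 1)) - \<epsilon> else 1 / (1 - \<theta>))"

end

theory Submission
  imports Defs "HOL-Probability.Probability"
begin

text \<open>
  Put \<open>a = - \<theta> > 0\<close>. The series is the sum of the residues at \<open>s = 1, 2, \<dots>\<close> of
  \<open>\<pi> / sin (\<pi> s) * exp (c s\<^sup>-\<^sup>a) * z\<^sup>s\<close>, so for \<open>\<bar>z\<bar> < 1\<close> it equals, up to the factor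
  \<open>- 1 / (2 \<pi> \<i>)\<close>, the integral of this kernel along a vertical line \<open>Re s = \<sigma>\<close> with \<open>0 < \<sigma> < 1\<close>
  (\<open>lindelof_integral_eq_series\<close>). On the line, \<open>1 / sin (\<pi> s)\<close> decays like \<open>exp (- \<pi> \<bar>Im s\<bar>)\<close>,
  whereas \<open>z\<^sup>s\<close> grows at most like \<open>exp (\<bar>arg z\<bar> \<bar>Im s\<bar>)\<close>. Hence the integral converges and is
  holomorphic on the whole plane cut along the negative axis. It therefore continues the series, and by
  the identity theorem it agrees there with the function of the theorem, for every choice of
  \<open>\<sigma>\<close> (\<open>E_fun_eq_lindelof_integral\<close>).

  The freedom to choose \<open>\<sigma>\<close> is what gives the asymptotics. Write \<open>l = ln \<bar>z\<bar>\<close>. The exponent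
  \<open>c s\<^sup>-\<^sup>a + s l\<close> has a saddle point on the positive axis, where \<open>l = a c \<sigma>\<^sup>-\<^sup>a\<^sup>-\<^sup>1\<close>; it tends to 0 as
  \<open>l\<close> grows. The vertical line through it needs no deformation, because
  \<open>\<bar>exp (c s\<^sup>-\<^sup>a)\<bar> \<le> exp (c \<bar>s\<bar>\<^sup>-\<^sup>a)\<close> already decreases away from the saddle. With
  \<open>N = \<sigma> l = a c \<sigma>\<^sup>-\<^sup>a\<close> and \<open>s = \<sigma> (1 + \<i> y)\<close> the exponent becomes
  \<open>N (1 + 1/a) - N (a + 1) y\<^sup>2 / 2 + O(N \<bar>y\<bar>\<^sup>3)\<close>. The rest of the kernel is \<open>1 / s\<close> times
  \<open>\<pi> s / sin (\<pi> s) * exp (\<i> s arg z) = 1 + O(\<bar>s\<bar>)\<close>. A Gaussian integral of width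
  \<open>N\<^sup>-\<^sup>1\<^sup>/\<^sup>2\<close> remains, which yields both constants, with a relative error \<open>O(N\<^sup>-\<^sup>1\<^sup>/\<^sup>2 + \<sigma>)\<close>
  (\<open>laplace_estimate\<close>, \<open>E_fun_saddle_estimate\<close>).

  As \<open>\<sigma>\<close> is of order \<open>l\<close> to the power \<open>- 1 / (1 + a)\<close>, and \<open>N\<^sup>-\<^sup>1\<^sup>/\<^sup>2\<close> of order \<open>l\<close> to the power
  \<open>- (a / 2) / (1 + a)\<close>, the error has the exponent \<open>min (a / 2) 1 / (1 + a)\<close>, whose two cases are
  those of \<open>\<mu>\<close> (up to \<open>\<epsilon>\<close>). Replacing \<open>l\<close> by the complex logarithm in the main term costs no more:
  the two differ by at most \<open>\<pi>\<close>, and the derivative of \<open>L\<close> to the power \<open>a / (1 + a)\<close> is of order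
  \<open>L\<close> to the power \<open>- 1 / (1 + a)\<close> (\<open>main_term_log_modulus_vs_log\<close>).
\<close>

section \<open>Lower bounds for the complex sine\<close>

text \<open>The two summands give the two lower bounds below: the second is useful on horizontal lines, and
  combining both by \<open>sinh\<^sup>2 = cosh\<^sup>2 - 1\<close> is useful on vertical lines that avoid the integers.\<close>
lemma norm_sin_sq: "(cmod (sin z))\<^sup>2 = (sin (Re z))\<^sup>2 + (sinh (Im z))\<^sup>2"
proof -
  have e: "exp (2 * Im z) = (exp (Im z))\<^sup>2" "inverse (exp (2 * Im z)) = (exp (- Im z))\<^sup>2"
    by (simp_all add: exp_double exp_minus power_inverse)
  have p: "exp (Im z) * exp (- Im z) = 1"
    by (simp flip: exp_add)
  have "4 * (sinh (Im z))\<^sup>2 = (exp (Im z))\<^sup>2 + (exp (- Im z))\<^sup>2 - 2"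
    using p by (simp add: sinh_field_def power_divide power2_diff)
  moreover have "cos (2 * Re z) = 1 - 2 * (sin (Re z))\<^sup>2"
    by (rule cos_double_sin)
  ultimately have "(exp (2 * Im z) + inverse (exp (2 * Im z)) - 2 * cos (2 * Re z)) / 4
      = (sin (Re z))\<^sup>2 + (sinh (Im z))\<^sup>2"
    using e by argo
  thus ?thesis by (simp only: norm_sin_squared)
qed

lemma norm_sin_ge_sinh: "\<bar>sinh (Im z)\<bar> \<le> cmod (sin z)"
  by (rule power2_le_imp_le) (simp_all add: norm_sin_sq)

lemma norm_sin_ge_cosh: "\<bar>sin (Re z)\<bar> * cosh (Im z) \<le> cmod (sin z)"
proof (rule power2_le_imp_le)
  have "(\<bar>sin (Re z)\<bar> * cosh (Im z))\<^sup>2 = (sin (Re z))\<^sup>2 + (sin (Re z))\<^sup>2 * (sinh (Im z))\<^sup>2"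
    by (simp add: power_mult_distrib cosh_square_eq algebra_simps)
  also have "\<dots> \<le> (sin (Re z))\<^sup>2 + 1 * (sinh (Im z))\<^sup>2"
    by (intro add_mono mult_right_mono) (auto simp: abs_square_le_1)
  finally show "(\<bar>sin (Re z)\<bar> * cosh (Im z))\<^sup>2 \<le> (cmod (sin z))\<^sup>2"
    by (simp add: norm_sin_sq)
qed simp

lemma cosh_ge_half_exp: "exp \<bar>y\<bar> / 2 \<le> cosh (y::real)"
  by (auto simp: cosh_field_def abs_if)

lemma norm_sin_ge_vertical:
  "\<bar>sin (Re z)\<bar> / 2 * exp \<bar>Im z\<bar> \<le> cmod (sin z)"
  using mult_left_mono[OF cosh_ge_half_exp[of "Im z"], of "\<bar>sin (Re z)\<bar>"] norm_sin_ge_cosh[of z]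
  by simp

lemma sinh_abs_ge:
  fixes y :: real assumes "1 \<le> \<bar>y\<bar>" shows "exp \<bar>y\<bar> / 4 \<le> \<bar>sinh y\<bar>"
proof -
  have "sinh \<bar>y\<bar> = (exp \<bar>y\<bar> - exp (- \<bar>y\<bar>)) / 2" by (simp add: sinh_field_def)
  moreover have "exp (- \<bar>y\<bar>) \<le> exp \<bar>y\<bar> / 2"
  proof -
    have "2 \<le> exp (2 * \<bar>y\<bar>)" using exp_ge_add_one_self[of "2*\<bar>y\<bar>"] assms by linarith
    hence "2 * exp (- \<bar>y\<bar>) \<le> exp (2 * \<bar>y\<bar>) * exp (- \<bar>y\<bar>)" by (intro mult_right_mono) auto
    also have "\<dots> = exp \<bar>y\<bar>" by (simp flip: exp_add)
    finally show ?thesis by simp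
  qed
  ultimately have "exp \<bar>y\<bar> / 4 \<le> sinh \<bar>y\<bar>" by argo
  thus ?thesis by simp
qed

lemma norm_sin_ge_horizontal:
  assumes "1 \<le> \<bar>Im z\<bar>" shows "1 / 4 * exp \<bar>Im z\<bar> \<le> cmod (sin z)"
  using sinh_abs_ge[OF assms] norm_sin_ge_sinh[of z] by simp

section \<open>The Lindelof kernel\<close>

text \<open>The last factor is the principal power \<open>z\<^sup>s\<close>, written as an exponential so that it is
  visibly entire in \<open>s\<close> and multiplicative.\<close>
definition lindelof_kernel :: "real \<Rightarrow> real \<Rightarrow> complex \<Rightarrow> complex \<Rightarrow> complex" where
  "lindelof_kernel c a z s =
     of_real pi / sin (of_real pi * s) * exp (of_real c * s powr of_real (- a)) * exp (s * Ln z)"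

lemma norm_exp_powr_le:
  assumes "c > 0" "a > 0" "\<sigma> > 0" "\<sigma> \<le> Re s"
  shows "cmod (exp (of_real c * s powr of_real (- a))) \<le> exp (c * \<sigma> powr (- a))"
proof -
  have "Re (of_real c * s powr of_real (- a)) \<le> cmod (of_real c * s powr of_real (- a))"
    by (rule complex_Re_le_cmod)
  also have "\<dots> = c * cmod s powr (- a)"
    using assms by (simp add: norm_mult norm_powr_real_powr')
  also have "\<dots> \<le> c * \<sigma> powr (- a)"
    using assms complex_Re_le_cmod[of s] by (intro mult_left_mono powr_mono2') auto
  finally show ?thesis by simp
qed

text \<open>The lower bound \<open>m\<close> for the sine is a parameter because the vertical and the horizontal sides of
  the contour need different ones. The last factor is where \<open>\<bar>arg z\<bar> < \<pi>\<close> enters: the decay of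
  the cosecant beats the growth of \<open>z\<^sup>s\<close>.\<close>
lemma norm_lindelof_kernel_le:
  assumes "c > 0" "a > 0" "\<sigma> > 0" "\<sigma> \<le> Re s" "m > 0"
    and "m * exp (pi * \<bar>Im s\<bar>) \<le> cmod (sin (of_real pi * s))"
    and "z \<noteq> 0"
  shows "cmod (lindelof_kernel c a z s) \<le>
     pi / m * exp (c * \<sigma> powr (- a)) * exp (Re s * ln (cmod z)) * exp (- (pi - \<bar>Im (Ln z)\<bar>) * \<bar>Im s\<bar>)"
proof -
  have sp: "cmod (sin (of_real pi * s)) > 0"
    using assms(5,6) by (smt (verit) exp_gt_zero mult_pos_pos)
  have "cmod (of_real pi / sin (of_real pi * s)) = pi / cmod (sin (of_real pi * s))"
    by (simp add: norm_divide)
  also have "\<dots> \<le> pi / (m * exp (pi * \<bar>Im s\<bar>))"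
    using assms sp by (intro divide_left_mono mult_pos_pos) auto
  also have "\<dots> = pi / m * exp (- pi * \<bar>Im s\<bar>)"
    by (simp add: exp_minus field_simps)
  finally have 1: "cmod (of_real pi / sin (of_real pi * s)) \<le> pi / m * exp (- pi * \<bar>Im s\<bar>)" .
  have "- (Im s * Im (Ln z)) \<le> \<bar>Im (Ln z)\<bar> * \<bar>Im s\<bar>"
    by (metis abs_ge_minus_self abs_mult mult.commute)
  hence 2: "cmod (exp (s * Ln z)) \<le> exp (Re s * ln (cmod z) + \<bar>Im (Ln z)\<bar> * \<bar>Im s\<bar>)"
    using assms(7) by (simp add: Re_Ln)
  have "cmod (lindelof_kernel c a z s) \<le> (pi / m * exp (- pi * \<bar>Im s\<bar>)) * exp (c * \<sigma> powr (- a))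
      * exp (Re s * ln (cmod z) + \<bar>Im (Ln z)\<bar> * \<bar>Im s\<bar>)"
    unfolding lindelof_kernel_def norm_mult
    using 1 2 norm_exp_powr_le[OF assms(1-4)] assms(5) by (intro mult_mono) auto
  also have "\<dots> = pi / m * exp (c * \<sigma> powr (- a)) * exp (Re s * ln (cmod z)) * exp (- (pi - \<bar>Im (Ln z)\<bar>) * \<bar>Im s\<bar>)"
  proof -
    have "exp (- pi * \<bar>Im s\<bar>) * exp (Re s * ln (cmod z) + \<bar>Im (Ln z)\<bar> * \<bar>Im s\<bar>)
        = exp (Re s * ln (cmod z)) * exp (- (pi - \<bar>Im (Ln z)\<bar>) * \<bar>Im s\<bar>)"
      unfolding exp_add[symmetric] by (rule arg_cong[of _ _ exp]) argo
    thus ?thesis by (simp only: mult_ac)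
  qed
  finally show ?thesis .
qed

lemma sin_pi_nonzero:
  assumes "0 < Re s" "s \<notin> \<int>" shows "sin (of_real pi * s) \<noteq> 0"
proof
  assume "sin (of_real pi * s) = 0"
  then obtain n::int where "of_real pi * s = of_real (n * pi)" by (auto simp: sin_eq_0)
  hence "s = of_int n" by (simp add: field_simps)
  thus False using assms(2) by auto
qed

lemma holomorphic_lindelof_kernel:
  "lindelof_kernel c a z holomorphic_on ({s. 0 < Re s} - \<int>)"
  unfolding lindelof_kernel_def
proof (intro holomorphic_intros)
  fix s assume s: "s \<in> {s. 0 < Re s} - \<int>"
  show "sin (complex_of_real pi * s) \<noteq> 0" using s sin_pi_nonzero by blast
  show "s \<notin> \<real>\<^sub>\<le>\<^sub>0" using s by (simp add: complex_nonpos_Reals_iff)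
qed

section \<open>The series as a line integral\<close>
lemma residue_lindelof_kernel:
  assumes "n \<ge> 1" "z \<noteq> 0"
  shows "residue (lindelof_kernel c a z) (of_nat n) = of_real (exp (c * real n powr (- a))) * (- z) ^ n"
proof (rule residue_simple')
  define h where "h = (\<lambda>s. exp (of_real c * s powr of_real (- a)) * exp (s * Ln z))"
  show "open (ball (of_nat n) 1 :: complex set)" "(of_nat n :: complex) \<in> ball (of_nat n) 1" by auto
  have sub: "ball (of_nat n) 1 - {of_nat n} \<subseteq> {s. 0 < Re s} - (\<int> :: complex set)"
  proof
    fix s :: complex assume s: "s \<in> ball (of_nat n) 1 - {of_nat n}"
    have "\<bar>Re (of_nat n - s)\<bar> < 1"
      using s abs_Re_le_cmod[of "of_nat n - s"] by (auto simp: dist_norm)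
    hence "0 < Re s" using assms(1) by auto
    moreover have "s \<notin> \<int>"
    proof
      assume "s \<in> \<int>"
      then obtain m where m: "s = of_int m" by (auto elim: Ints_cases)
      have "\<bar>real n - of_int m\<bar> < 1" using \<open>\<bar>Re (of_nat n - s)\<bar> < 1\<close> m by simp
      hence "m = int n" by linarith
      thus False using s m by auto
    qed
    ultimately show "s \<in> {s. 0 < Re s} - \<int>" by auto
  qed
  show "lindelof_kernel c a z holomorphic_on ball (of_nat n) 1 - {of_nat n}"
    by (rule holomorphic_on_subset[OF holomorphic_lindelof_kernel sub])
  have cospi: "cos (of_real pi * of_nat n :: complex) = (- 1) ^ n"
    by (metis cos_of_real cos_npi mult.commute of_real_mult of_real_of_nat_eq of_real_power of_real_minus of_real_1)
  have sinpi: "sin (of_real pi * of_nat n :: complex) = 0"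
    by (metis sin_of_real sin_npi mult.commute of_real_mult of_real_of_nat_eq of_real_0)
  have "((\<lambda>s. sin (of_real pi * s)) has_field_derivative of_real pi * cos (of_real pi * of_nat n)) (at (of_nat n :: complex))"
    by (auto intro!: derivative_eq_intros)
  hence "((\<lambda>s. sin (of_real pi * s) / (s - of_nat n)) \<longlongrightarrow> of_real pi * (- 1) ^ n) (at (of_nat n :: complex))"
    by (simp add: has_field_derivative_iff sinpi cospi)
  hence 1: "((\<lambda>s. of_real pi / (sin (of_real pi * s) / (s - of_nat n))) \<longlongrightarrow> of_real pi / (of_real pi * (- 1) ^ n)) (at (of_nat n :: complex))"
    by (intro tendsto_divide tendsto_const) auto
  have "isCont h (of_nat n)"
    unfolding h_def using assms(1)
    by (intro continuous_intros) (auto simp: complex_nonpos_Reals_iff)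
  hence 2: "(h \<longlongrightarrow> h (of_nat n)) (at (of_nat n))" by (simp add: isCont_def)
  have "h (of_nat n) = of_real (exp (c * real n powr (- a))) * z ^ n"
  proof -
    have "(of_nat n :: complex) powr of_real (- a) = of_real (real n powr (- a))"
      using powr_of_real[of "real n" "-a"] by simp
    thus ?thesis using assms(2) by (simp add: h_def exp_of_nat_mult flip: exp_of_real)
  qed
  moreover have "of_real pi / (of_real pi * (- 1) ^ n) = (- 1 :: complex) ^ n"
    by (cases "even n") auto
  moreover have "(- z) ^ n = (- 1) ^ n * z ^ n"
    by (rule power_minus)
  ultimately have v: "of_real (exp (c * real n powr (- a))) * (- z) ^ n = of_real pi / (of_real pi * (- 1) ^ n) * h (of_nat n)"
    by simp
  have eq: "of_real pi / (sin (of_real pi * s) / (s - of_nat n)) * h s = lindelof_kernel c a z s * (s - of_nat n)" for s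
    by (simp add: lindelof_kernel_def h_def)
  show "((\<lambda>s. lindelof_kernel c a z s * (s - of_nat n)) \<longlongrightarrow> of_real (exp (c * real n powr (- a))) * (- z) ^ n)
      (at (of_nat n))"
    using tendsto_mult[OF 1 2] unfolding v eq .
qed

text \<open>The right side lies halfway between two integers, where \<open>\<bar>sin (\<pi> Re s)\<bar> = 1\<close>.\<close>
lemma rectangle_lindelof_kernel:
  fixes M :: nat
  assumes "0 < \<sigma>" "\<sigma> < 1" "M \<ge> 1" "z \<noteq> 0"
  shows "contour_integral (rectpath (Complex \<sigma> (- real M)) (Complex (real M + 1/2) (real M))) (lindelof_kernel c a z)
     = 2 * of_real pi * \<i> * (\<Sum>n<M. of_real (exp (c * real (Suc n) powr (- a))) * (- z) ^ Suc n)"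
proof -
  define S where "S = {s. 0 < Re s} \<inter> {s. Re s < real M + 1}"
  define pts where "pts = (of_nat ` {1..M} :: complex set)"
  let ?g = "rectpath (Complex \<sigma> (- real M)) (Complex (real M + 1/2) (real M))"
  have sub: "S - pts \<subseteq> {s. 0 < Re s} - \<int>"
  proof
    fix s assume s: "s \<in> S - pts"
    have "s \<notin> \<int>"
    proof
      assume "s \<in> \<int>"
      then obtain m where m: "s = of_int m" by (auto elim: Ints_cases)
      with s have "0 < m" "m < int M + 1" by (auto simp: S_def)
      hence "s = of_nat (nat m)" "nat m \<in> {1..M}" by (auto simp: m)
      thus False using s by (auto simp: pts_def)
    qed
    thus "s \<in> {s. 0 < Re s} - \<int>" using s by (auto simp: S_def)
  qed
  have path: "path_image ?g = {s. Re s \<in> {\<sigma>, real M + 1/2} \<and> Im s \<in> {- real M..real M}} \<union>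
           {s. Im s \<in> {- real M, real M} \<and> Re s \<in> {\<sigma>..real M + 1/2}}"
    using assms by (subst path_image_rectpath) auto
  have "contour_integral ?g (lindelof_kernel c a z) =
      2 * pi * \<i> * (\<Sum>p\<in>pts. winding_number ?g p * residue (lindelof_kernel c a z) p)"
  proof (rule Residue_theorem)
    show "open S" unfolding S_def by (intro open_Int open_halfspace_Re_gt open_halfspace_Re_lt)
    have cv: "convex S" unfolding S_def by (intro convex_Int convex_halfspace_Re_gt convex_halfspace_Re_lt)
    thus "connected S" by (rule convex_connected)
    show "lindelof_kernel c a z holomorphic_on S - pts"
      by (rule holomorphic_on_subset[OF holomorphic_lindelof_kernel sub])
    show im: "path_image ?g \<subseteq> S - pts"
    proof
      fix s assume s: "s \<in> path_image ?g"
      have "s \<notin> pts"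
      proof
        assume "s \<in> pts"
        then obtain n where n: "s = of_nat n" "1 \<le> n" by (auto simp: pts_def)
        have "real n \<noteq> real M + 1/2"
        proof
          assume "real n = real M + 1/2"
          hence "real (2 * n) = real (2 * M + 1)" by simp
          hence "2 * n = 2 * M + 1" by (simp only: of_nat_eq_iff)
          thus False by presburger
        qed
        thus False using s n assms unfolding path by auto
      qed
      thus "s \<in> S - pts" using s assms unfolding path by (auto simp: S_def)
    qed
    show "\<forall>s. s \<notin> S \<longrightarrow> winding_number ?g s = 0"
      using im by (intro allI impI winding_number_zero_outside[OF _ cv]) auto
  qed (auto simp: pts_def)
  also have "(\<Sum>p\<in>pts. winding_number ?g p * residue (lindelof_kernel c a z) p)
      = (\<Sum>n\<in>{1..M}. winding_number ?g (of_nat n) * residue (lindelof_kernel c a z) (of_nat n))"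
    unfolding pts_def by (subst sum.reindex) (auto simp: inj_on_def)
  also have "\<dots> = (\<Sum>n\<in>{1..M}. of_real (exp (c * real n powr (- a))) * (- z) ^ n)"
  proof (rule sum.cong)
    fix n assume n: "n \<in> {1..M}"
    hence "winding_number ?g (of_nat n) = 1"
      using assms by (intro winding_number_rectpath) (auto simp: in_box_complex_iff)
    thus "winding_number ?g (of_nat n) * residue (lindelof_kernel c a z) (of_nat n)
        = of_real (exp (c * real n powr (- a))) * (- z) ^ n"
      using n assms by (simp add: residue_lindelof_kernel)
  qed simp
  also have "{1..M} = Suc ` {..<M}"
    by (metis One_nat_def image_Suc_lessThan)
  also have "(\<Sum>n\<in>Suc ` {..<M}. of_real (exp (c * real n powr (- a))) * (- z) ^ n)
      = (\<Sum>n<M. of_real (exp (c * real (Suc n) powr (- a))) * (- z) ^ Suc n)"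
    by (subst sum.reindex) auto
  finally show ?thesis by simp
qed

text \<open>The left side of the rectangle is the truncated line integral. The two summands of the bound
  come from the horizontal sides, where the kernel is exponentially small in the height, and from the
  right side, where \<open>\<bar>z\<bar>\<^sup>s\<close> is small as \<open>\<bar>z\<bar> < 1\<close>.\<close>
lemma truncated_line_integral_bound:
  fixes M :: nat
  assumes "0 < \<sigma>" "\<sigma> < 1" "M \<ge> 1" "z \<noteq> 0" "cmod z < 1" "a > 0" "c > 0"
  defines "K \<equiv> exp (c * \<sigma> powr (- a))" and "\<eta> \<equiv> pi - \<bar>Im (Ln z)\<bar>"
  shows "cmod (integral {- real M..real M} (\<lambda>t. lindelof_kernel c a z (Complex \<sigma> t)) +
           2 * of_real pi * (\<Sum>n<M. of_real (exp (c * real (Suc n) powr (- a))) * (- z) ^ Suc n))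
    \<le> 2 * (4 * pi * K * exp (- \<eta> * real M) * (real M + 1/2 - \<sigma>))
        + 2 * pi * K * exp ((real M + 1/2) * ln (cmod z)) * (2 * real M)"
proof -
  define A B C D where "A = Complex \<sigma> (- real M)" and "B = Complex (real M + 1/2) (- real M)"
    and "C = Complex (real M + 1/2) (real M)" and "D = Complex \<sigma> (real M)"
  let ?F = "lindelof_kernel c a z"
  let ?S = "\<Sum>n<M. of_real (exp (c * real (Suc n) powr (- a))) * (- z) ^ Suc n"
  have M: "real M \<ge> 1" using assms(3) by simp
  have lnz: "ln (cmod z) < 0" using assms(4,5) by simp
  have eta: "\<eta> \<ge> 0" unfolding \<eta>_def using Im_Ln_le_pi[OF assms(4)] mpi_less_Im_Ln[OF assms(4)] by auto
  have nonint: "s \<notin> \<int>" if "Im s \<noteq> 0 \<or> Re s \<notin> \<int>" for s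
    using that by (auto elim!: Ints_cases)
  have half: "real M + 1/2 \<notin> \<int>"
  proof
    assume "real M + 1/2 \<in> \<int>"
    then obtain k where "real M + 1/2 = of_int k" by (auto elim: Ints_cases)
    hence "real_of_int (2 * k) = real_of_int (2 * int M + 1)" by simp
    hence "2 * k = 2 * int M + 1" by (simp only: of_int_eq_iff)
    thus False by presburger
  qed
  have sg: "\<sigma> \<notin> \<int>" using assms(1,2) by (auto elim!: Ints_cases)
  have seg: "closed_segment A B = {s. Im s = - real M \<and> Re s \<in> {\<sigma>..real M + 1/2}}"
            "closed_segment C D = {s. Im s = real M \<and> Re s \<in> {\<sigma>..real M + 1/2}}"
            "closed_segment B C = {s. Re s = real M + 1/2 \<and> Im s \<in> {- real M..real M}}"
            "closed_segment A D = {s. Re s = \<sigma> \<and> Im s \<in> {- real M..real M}}"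
    using assms(1,2) M unfolding A_def B_def C_def D_def
    by (auto simp: closed_segment_same_Re closed_segment_same_Im closed_segment_eq_real_ivl)
  have cont: "continuous_on X ?F" if "X \<subseteq> {s. 0 < Re s} - \<int>" for X
    using holomorphic_on_imp_continuous_on[OF holomorphic_lindelof_kernel] continuous_on_subset that by blast
  have "closed_segment A B \<subseteq> {s. 0 < Re s} - \<int>" "closed_segment C D \<subseteq> {s. 0 < Re s} - \<int>"
    unfolding seg using assms(1) M by (auto intro!: nonint)
  hence c1: "continuous_on (closed_segment A B) ?F" "continuous_on (closed_segment C D) ?F"
    by (auto intro: cont)
  have "closed_segment B C \<subseteq> {s. 0 < Re s} - \<int>" "closed_segment A D \<subseteq> {s. 0 < Re s} - \<int>"
    unfolding seg using assms(1) M half sg by (auto intro!: nonint)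
  hence c2: "continuous_on (closed_segment B C) ?F" "continuous_on (closed_segment A D) ?F"
    by (auto intro: cont)
  have c3: "continuous_on (closed_segment D A) ?F" using c2(2) by (simp add: closed_segment_commute)
  note ci = contour_integrable_continuous_linepath[OF c1(1)] contour_integrable_continuous_linepath[OF c1(2)]
    contour_integrable_continuous_linepath[OF c2(1)] contour_integrable_continuous_linepath[OF c3]
  have rp: "rectpath A C = linepath A B +++ linepath B C +++ linepath C D +++ linepath D A"
    by (simp add: rectpath_def Let_def A_def B_def C_def D_def)
  have "contour_integral (rectpath A C) ?F = contour_integral (linepath A B) ?F + (contour_integral (linepath B C) ?F +
      (contour_integral (linepath C D) ?F + contour_integral (linepath D A) ?F))"
    unfolding rp using ci by simp
  moreover have "contour_integral (linepath D A) ?F = - contour_integral (linepath A D) ?F"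
    by (rule contour_integral_reverse_linepath[OF c3])
  moreover have "contour_integral (linepath A D) ?F = \<i> * integral {- real M..real M} (\<lambda>t. ?F (Complex \<sigma> t))"
    using M by (intro contour_integral_linepath_same_Re) (auto simp: A_def D_def)
  moreover have "contour_integral (rectpath A C) ?F = 2 * of_real pi * \<i> * ?S"
    unfolding A_def C_def by (rule rectangle_lindelof_kernel) (use assms in auto)
  ultimately have eq: "\<i> * (integral {- real M..real M} (\<lambda>t. ?F (Complex \<sigma> t)) + 2 * of_real pi * ?S)
     = contour_integral (linepath A B) ?F + contour_integral (linepath B C) ?F + contour_integral (linepath C D) ?F"
    by (simp add: algebra_simps)
  have "cmod (integral {- real M..real M} (\<lambda>t. ?F (Complex \<sigma> t)) + 2 * of_real pi * ?S)
     = cmod (\<i> * (integral {- real M..real M} (\<lambda>t. ?F (Complex \<sigma> t)) + 2 * of_real pi * ?S))"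
    by (simp only: norm_mult norm_ii mult_1)
  also note eq
  also have "cmod (contour_integral (linepath A B) ?F + contour_integral (linepath B C) ?F + contour_integral (linepath C D) ?F)
      \<le> cmod (contour_integral (linepath A B) ?F) + cmod (contour_integral (linepath B C) ?F)
      + cmod (contour_integral (linepath C D) ?F)"
    by (intro norm_triangle_le add_mono order_refl)
  also have "\<dots> \<le> (4 * pi * K * exp (- \<eta> * real M)) * cmod (B - A)
      + (2 * pi * K * exp ((real M + 1/2) * ln (cmod z))) * cmod (C - B)
      + (4 * pi * K * exp (- \<eta> * real M)) * cmod (D - C)"
  proof (intro add_mono contour_integral_bound_linepath ci)
    have hor: "cmod (?F s) \<le> 4 * pi * K * exp (- \<eta> * real M)" if "\<bar>Im s\<bar> = real M" "\<sigma> \<le> Re s" for s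
    proof -
      have "1 * 1 \<le> pi * real M" using M pi_gt3 by (intro mult_mono) auto
      hence "1/4 * exp (pi * \<bar>Im s\<bar>) \<le> cmod (sin (of_real pi * s))"
        using norm_sin_ge_horizontal[of "of_real pi * s"] that by (simp add: abs_mult)
      from norm_lindelof_kernel_le[OF assms(7,6,1) that(2) _ this assms(4)]
      have "cmod (?F s) \<le> (pi / (1/4) * K) * exp (Re s * ln (cmod z)) * exp (- \<eta> * real M)"
        by (simp add: K_def \<eta>_def that)
      also have "\<dots> \<le> (pi / (1/4) * K) * 1 * exp (- \<eta> * real M)"
        using that assms(1) lnz by (intro mult_right_mono mult_left_mono) (auto simp: K_def mult_nonneg_nonpos)
      finally show ?thesis by (simp add: mult_ac)
    qed
    show "cmod (?F s) \<le> 4 * pi * K * exp (- \<eta> * real M)" if "s \<in> closed_segment A B" for s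
      using that hor[of s] unfolding seg by auto
    show "cmod (?F s) \<le> 4 * pi * K * exp (- \<eta> * real M)" if "s \<in> closed_segment C D" for s
      using that hor[of s] unfolding seg by auto
    show "cmod (?F s) \<le> 2 * pi * K * exp ((real M + 1/2) * ln (cmod z))" if "s \<in> closed_segment B C" for s
    proof -
      have s: "Re s = real M + 1/2" "\<sigma> \<le> Re s" using that assms(2) M unfolding seg by auto
      (* The right side crosses the real axis, so only the real part of s can bound the sine there. *)
      have "sin (pi * Re s) = (- 1) ^ M"
      proof -
        have "pi * Re s = real M * pi + pi / 2" by (simp add: s algebra_simps)
        thus ?thesis by (simp add: sin_add)
      qed
      hence "\<bar>sin (pi * Re s)\<bar> = 1" by (simp add: power_abs)
      hence "1/2 * exp (pi * \<bar>Im s\<bar>) \<le> cmod (sin (of_real pi * s))"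
        using norm_sin_ge_vertical[of "of_real pi * s"] by (simp add: abs_mult)
      from norm_lindelof_kernel_le[OF assms(7,6,1) s(2) _ this assms(4)]
      have "cmod (?F s) \<le> (pi / (1/2) * K * exp (Re s * ln (cmod z))) * exp (- \<eta> * \<bar>Im s\<bar>)"
        by (simp add: K_def \<eta>_def)
      also have "\<dots> \<le> (pi / (1/2) * K * exp (Re s * ln (cmod z))) * 1"
        using eta by (intro mult_left_mono) (auto simp: K_def)
      finally show ?thesis by (simp add: s mult_ac)
    qed
  qed (auto simp: K_def)
  also have "cmod (B - A) = real M + 1/2 - \<sigma>"
  proof -
    have "B - A = of_real (real M + 1/2 - \<sigma>)" by (simp add: A_def B_def complex_eq_iff)
    thus ?thesis using assms(2) M by (simp only: norm_of_real abs_minus_cancel)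
  qed
  also have "cmod (D - C) = real M + 1/2 - \<sigma>"
  proof -
    have "D - C = of_real (- (real M + 1/2 - \<sigma>))" by (simp add: C_def D_def complex_eq_iff)
    thus ?thesis using assms(2) M by (simp only: norm_of_real abs_minus_cancel)
  qed
  also have "cmod (C - B) = 2 * real M"
  proof -
    have "C - B = \<i> * of_real (2 * real M)" by (simp add: B_def C_def complex_eq_iff)
    thus ?thesis by (simp add: norm_mult)
  qed
  finally show ?thesis by (simp add: algebra_simps)
qed

section \<open>Analytic continuation by the line integral\<close>
lemma integrable_exp_abs:
  assumes "\<eta> > 0" shows "integrable lborel (\<lambda>t::real. exp (- \<eta> * \<bar>t\<bar>))"
proof -
  have "has_bochner_integral lborel (\<lambda>x::real. indicator {0..} x *\<^sub>R exp (- \<bar>x\<bar>)) (fact 0)"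
    by (rule has_bochner_integral_cong[THEN iffD1, OF _ _ _ has_bochner_integral_I0i_power_exp_m'[of 0]])
       (auto simp: indicator_def)
  from has_bochner_integral_even_function[OF this]
  have "integrable lborel (\<lambda>x::real. exp (- \<bar>x\<bar>))"
    by (auto intro: integrable.intros)
  from lborel_integrable_real_affine[OF this, of \<eta> 0] assms
  show ?thesis by (simp add: abs_mult)
qed

definition lindelof_integral :: "real \<Rightarrow> real \<Rightarrow> real \<Rightarrow> complex \<Rightarrow> complex" where
  "lindelof_integral c a \<sigma> z = (LINT t|lborel. lindelof_kernel c a z (Complex \<sigma> t))"

text \<open>A majorant for what truncation at height \<open>M\<close> cuts off, up to a factor; it depends on \<open>z\<close> only
  through \<open>\<eta>\<close>, which makes the truncation locally uniform in \<open>z\<close>.\<close>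
definition exp_tail :: "real \<Rightarrow> nat \<Rightarrow> real" where
  "exp_tail \<eta> M = (LINT t|lborel. indicator (- {- real M..real M}) t * exp (- \<eta> * \<bar>t\<bar>))"

lemma exp_tail_tendsto_0:
  assumes "\<eta> > 0" shows "exp_tail \<eta> \<longlonglongrightarrow> 0"
proof -
  have "(\<lambda>M. LINT t|lborel. indicator (- {- real M..real M}) t * exp (- \<eta> * \<bar>t\<bar>)) \<longlonglongrightarrow> integral\<^sup>L lborel (\<lambda>t::real. 0)"
  proof (rule Bochner_Integration.integral_dominated_convergence[where w = "\<lambda>t. exp (- \<eta> * \<bar>t\<bar>)"])
    show "integrable lborel (\<lambda>t. exp (- \<eta> * \<bar>t\<bar>))" by (rule integrable_exp_abs[OF assms])
    show "AE t in lborel. (\<lambda>M. indicator (- {- real M..real M}) t * exp (- \<eta> * \<bar>t\<bar>)) \<longlonglongrightarrow> 0"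
    proof (rule AE_I2)
      fix t :: real
      obtain N where N: "\<bar>t\<bar> \<le> real N" using real_arch_simple by blast
      have "eventually (\<lambda>M. indicator (- {- real M..real M}) t * exp (- \<eta> * \<bar>t\<bar>) = 0) sequentially"
        using eventually_ge_at_top[of N]
      proof eventually_elim
        case (elim M)
        hence "real N \<le> real M" by simp
        with N have "\<bar>t\<bar> \<le> real M" by linarith
        thus ?case by (auto simp: indicator_def abs_le_iff)
      qed
      thus "(\<lambda>M. indicator (- {- real M..real M}) t * exp (- \<eta> * \<bar>t\<bar>)) \<longlonglongrightarrow> 0"
        by (rule tendsto_eventually)
    qed
  qed (auto simp: indicator_def)
  thus ?thesis by (simp add: exp_tail_def[abs_def])
qed

lemma sin_pi_pos: assumes "0 < \<sigma>" "\<sigma> < 1" shows "sin (pi * \<sigma>) > 0"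
proof (rule sin_gt_zero)
  show "0 < pi * \<sigma>" using assms(1) by simp
  show "pi * \<sigma> < pi" using mult_strict_left_mono[OF assms(2) pi_gt_zero] by simp
qed

lemma norm_lindelof_kernel_line_le:
  assumes "c > 0" "a > 0" "0 < \<sigma>" "\<sigma> < 1" "z \<noteq> 0" "\<eta> \<le> pi - \<bar>Im (Ln z)\<bar>"
  shows "cmod (lindelof_kernel c a z (Complex \<sigma> t)) \<le>
     2 * pi / sin (pi * \<sigma>) * exp (c * \<sigma> powr (- a)) * exp (\<sigma> * ln (cmod z)) * exp (- \<eta> * \<bar>t\<bar>)"
proof -
  note sp = sin_pi_pos[OF assms(3,4)]
  have "sin (pi * \<sigma>) / 2 * exp (pi * \<bar>t\<bar>) \<le> cmod (sin (of_real pi * Complex \<sigma> t))"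
    using norm_sin_ge_vertical[of "of_real pi * Complex \<sigma> t"] sp by (simp add: abs_mult)
  hence "cmod (lindelof_kernel c a z (Complex \<sigma> t)) \<le>
     pi / (sin (pi * \<sigma>) / 2) * exp (c * \<sigma> powr (- a)) * exp (\<sigma> * ln (cmod z)) * exp (- (pi - \<bar>Im (Ln z)\<bar>) * \<bar>t\<bar>)"
    using norm_lindelof_kernel_le[OF assms(1-3), of "Complex \<sigma> t" "sin (pi * \<sigma>) / 2" z] sp assms(5) by simp
  also have "\<dots> \<le> pi / (sin (pi * \<sigma>) / 2) * exp (c * \<sigma> powr (- a)) * exp (\<sigma> * ln (cmod z)) * exp (- \<eta> * \<bar>t\<bar>)"
  proof (rule mult_left_mono)
    have "- (pi - \<bar>Im (Ln z)\<bar>) * \<bar>t\<bar> \<le> - \<eta> * \<bar>t\<bar>"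
      using assms(6) by (intro mult_right_mono) auto
    thus "exp (- (pi - \<bar>Im (Ln z)\<bar>) * \<bar>t\<bar>) \<le> exp (- \<eta> * \<bar>t\<bar>)" by (simp only: exp_le_cancel_iff)
  qed (use sp in auto)
  finally show ?thesis by (simp add: mult_ac)
qed

lemma continuous_on_lindelof_kernel_line:
  assumes "0 < \<sigma>" "\<sigma> < 1"
  shows "continuous_on UNIV (\<lambda>t. lindelof_kernel c a z (Complex \<sigma> t))"
proof (rule continuous_on_compose2[OF holomorphic_on_imp_continuous_on[OF holomorphic_lindelof_kernel]])
  show "continuous_on UNIV (Complex \<sigma>)"
    unfolding Complex_eq by (intro continuous_intros)
  have "Complex \<sigma> t \<notin> \<int>" for t
    using assms by (auto elim!: Ints_cases simp: complex_eq_iff)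
  thus "range (Complex \<sigma>) \<subseteq> {s. 0 < Re s} - \<int>" using assms(1) by auto
qed

lemma Im_Ln_lt_pi:
  assumes "z \<notin> \<real>\<^sub>\<le>\<^sub>0" shows "\<bar>Im (Ln z)\<bar> < pi"
proof -
  have z: "z \<noteq> 0" using assms by auto
  have "Im (Ln z) \<noteq> pi"
    using Im_Ln_eq_pi[OF z] assms by (auto simp: complex_nonpos_Reals_iff)
  thus ?thesis using mpi_less_Im_Ln[OF z] Im_Ln_le_pi[OF z] by linarith
qed

lemma integrable_lindelof_kernel_line:
  assumes "c > 0" "a > 0" "0 < \<sigma>" "\<sigma> < 1" "z \<notin> \<real>\<^sub>\<le>\<^sub>0"
  shows "integrable lborel (\<lambda>t. lindelof_kernel c a z (Complex \<sigma> t))"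
proof (rule Bochner_Integration.integrable_bound)
  have z: "z \<noteq> 0" using assms(5) by auto
  show "integrable lborel (\<lambda>t. 2 * pi / sin (pi * \<sigma>) * exp (c * \<sigma> powr (- a)) * exp (\<sigma> * ln (cmod z))
      * exp (- (pi - \<bar>Im (Ln z)\<bar>) * \<bar>t\<bar>))"
    using Im_Ln_lt_pi[OF assms(5)] by (intro integrable_mult_right integrable_exp_abs) auto
  show "(\<lambda>t. lindelof_kernel c a z (Complex \<sigma> t)) \<in> borel_measurable lborel"
    using continuous_on_lindelof_kernel_line[OF assms(3,4)] by (auto intro: borel_measurable_continuous_onI)
  show "AE t in lborel. norm (lindelof_kernel c a z (Complex \<sigma> t)) \<le>
      norm (2 * pi / sin (pi * \<sigma>) * exp (c * \<sigma> powr (- a)) * exp (\<sigma> * ln (cmod z))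
      * exp (- (pi - \<bar>Im (Ln z)\<bar>) * \<bar>t\<bar>))"
    using order_trans[OF norm_lindelof_kernel_line_le[OF assms(1-4) z order_refl] abs_ge_self] by auto
qed

lemma lindelof_integral_truncation:
  assumes "c > 0" "a > 0" "0 < \<sigma>" "\<sigma> < 1" "z \<notin> \<real>\<^sub>\<le>\<^sub>0" "0 < \<eta>" "\<eta> \<le> pi - \<bar>Im (Ln z)\<bar>"
  shows "cmod (lindelof_integral c a \<sigma> z - integral {- real M..real M} (\<lambda>t. lindelof_kernel c a z (Complex \<sigma> t)))
    \<le> 2 * pi / sin (pi * \<sigma>) * exp (c * \<sigma> powr (- a)) * exp (\<sigma> * ln (cmod z)) * exp_tail \<eta> M"
proof -
  let ?F = "\<lambda>t. lindelof_kernel c a z (Complex \<sigma> t)" and ?I = "{- real M..real M}"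
  define B where "B = 2 * pi / sin (pi * \<sigma>) * exp (c * \<sigma> powr (- a)) * exp (\<sigma> * ln (cmod z))"
  have z: "z \<noteq> 0" using assms(5) by auto
  have int: "integrable lborel ?F" by (rule integrable_lindelof_kernel_line[OF assms(1-5)])
  have int2: "set_integrable lborel ?I ?F"
    unfolding set_integrable_def by (intro integrable_mult_indicator int) auto
  have int3: "integrable lborel (\<lambda>t. indicator (- ?I) t *\<^sub>R ?F t)"
    by (intro integrable_mult_indicator int) auto
  have int4: "integrable lborel (\<lambda>t. indicator (- ?I) t * exp (- \<eta> * \<bar>t\<bar>))"
    using integrable_mult_indicator[OF _ integrable_exp_abs[OF assms(6)], of "- ?I"] by simp
  have "lindelof_integral c a \<sigma> z - integral ?I ?F
      = (LINT t|lborel. ?F t) - (LINT t|lborel. indicator ?I t *\<^sub>R ?F t)"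
    using set_borel_integral_eq_integral(2)[OF int2]
    by (simp add: lindelof_integral_def set_lebesgue_integral_def)
  also have "\<dots> = (LINT t|lborel. ?F t - indicator ?I t *\<^sub>R ?F t)"
    using int int2 unfolding set_integrable_def by (rule Bochner_Integration.integral_diff[symmetric])
  also have "\<dots> = (LINT t|lborel. indicator (- ?I) t *\<^sub>R ?F t)"
    by (rule Bochner_Integration.integral_cong) (auto simp: indicator_def)
  also have "cmod \<dots> \<le> (LINT t|lborel. B * (indicator (- ?I) t * exp (- \<eta> * \<bar>t\<bar>)))"
  proof (rule Bochner_Integration.integral_norm_bound_integral[OF int3])
    show "integrable lborel (\<lambda>t. B * (indicator (- ?I) t * exp (- \<eta> * \<bar>t\<bar>)))"
      by (intro integrable_mult_right int4)
    show "norm (indicator (- ?I) t *\<^sub>R ?F t) \<le> B * (indicator (- ?I) t * exp (- \<eta> * \<bar>t\<bar>))" for t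
      using norm_lindelof_kernel_line_le[OF assms(1-4) z assms(7), of t] unfolding B_def[symmetric]
      by (cases "t \<in> ?I") simp_all
  qed
  also have "\<dots> = B * exp_tail \<eta> M"
    unfolding exp_tail_def by simp
  finally show ?thesis unfolding B_def .
qed

lemma E_series_summable:
  assumes "c > 0" "a > 0" "cmod z < 1"
  shows "summable (\<lambda>n. of_real (exp (c * real (Suc n) powr (- a))) * (- z) ^ Suc n :: complex)"
    (is "summable ?t")
proof (rule summable_comparison_test')
  show "summable (\<lambda>n. exp c * cmod z ^ Suc n)"
    using assms(3) by (intro summable_mult) (simp add: summable_Suc_iff summable_geometric)
  show "cmod (?t n) \<le> exp c * cmod z ^ Suc n" if "n \<ge> 0" for n
  proof -
    have "real (Suc n) powr (- a) \<le> 1"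
      using assms(2) powr_mono2'[of "- a" 1 "real (Suc n)"] by simp
    hence "c * real (Suc n) powr (- a) \<le> c * 1" using assms(1) by (intro mult_left_mono) auto
    hence "exp (c * real (Suc n) powr (- a)) \<le> exp c" by simp
    thus ?thesis unfolding norm_mult norm_power norm_minus_cancel norm_of_real
      by (intro mult_right_mono) auto
  qed
qed

text \<open>As the rectangle grows, its left side tends to the full line integral and its other sides
  contribute nothing in the limit. The sign comes from the orientation: the poles lie to the right of
  the line.\<close>
lemma lindelof_integral_eq_series:
  assumes "c > 0" "a > 0" "0 < \<sigma>" "\<sigma> < 1" "z \<notin> \<real>\<^sub>\<le>\<^sub>0" "cmod z < 1"
  shows "lindelof_integral c a \<sigma> z = - (2 * of_real pi * E_series c (- a) z)"
proof -
  have z: "z \<noteq> 0" using assms(5) by auto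
  define \<eta> where "\<eta> = pi - \<bar>Im (Ln z)\<bar>"
  define K where "K = exp (c * \<sigma> powr (- a))"
  have eta: "\<eta> > 0" using Im_Ln_lt_pi[OF assms(5)] by (simp add: \<eta>_def)
  define l where "l = - ln (cmod z)"
  have l: "l > 0" using assms(6) z by (simp add: l_def)
  let ?t = "\<lambda>n. of_real (exp (c * real (Suc n) powr (- a))) * (- z) ^ Suc n"
  let ?L = "\<lambda>M::nat. integral {- real M..real M} (\<lambda>t. lindelof_kernel c a z (Complex \<sigma> t))"
  have "summable ?t" using E_series_summable[OF assms(1,2,6)] .
  hence S: "(\<lambda>M. \<Sum>n<M. ?t n) \<longlonglongrightarrow> E_series c (- a) z"
    unfolding E_series_def by (rule summable_LIMSEQ)
  have L: "?L \<longlonglongrightarrow> lindelof_integral c a \<sigma> z"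
  proof (rule LIM_zero_cancel, rule Lim_null_comparison)
    show "eventually (\<lambda>M. norm (?L M - lindelof_integral c a \<sigma> z) \<le>
      2 * pi / sin (pi * \<sigma>) * exp (c * \<sigma> powr (- a)) * exp (\<sigma> * ln (cmod z)) * exp_tail \<eta> M) sequentially"
      using lindelof_integral_truncation[OF assms(1-5) eta] by (simp add: \<eta>_def norm_minus_commute)
    show "(\<lambda>M. 2 * pi / sin (pi * \<sigma>) * exp (c * \<sigma> powr (- a)) * exp (\<sigma> * ln (cmod z)) * exp_tail \<eta> M) \<longlonglongrightarrow> 0"
      by (intro tendsto_mult_right_zero exp_tail_tendsto_0 eta)
  qed
  have "(\<lambda>M. ?L M + 2 * of_real pi * (\<Sum>n<M. ?t n)) \<longlonglongrightarrow> 0"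
  proof (rule Lim_null_comparison)
    show "eventually (\<lambda>M. norm (?L M + 2 * of_real pi * (\<Sum>n<M. ?t n)) \<le>
        2 * (4 * pi * K * exp (- \<eta> * real M) * (real M + 1/2 - \<sigma>))
        + 2 * pi * K * exp ((real M + 1/2) * (- l)) * (2 * real M)) sequentially"
      using eventually_ge_at_top[of 1]
    proof eventually_elim
      case (elim M)
      thus ?case using truncated_line_integral_bound[OF assms(3,4) elim z assms(6,2,1)]
        by (simp add: K_def \<eta>_def l_def)
    qed
    have "(\<lambda>M. exp (- \<eta> * real M) * (real M + 1/2 - \<sigma>)) \<longlonglongrightarrow> 0"
      "(\<lambda>M. exp ((real M + 1/2) * (- l)) * (2 * real M)) \<longlonglongrightarrow> 0"
      using eta l by real_asymp+
    hence "(\<lambda>M. 2 * (4 * pi * K * (exp (- \<eta> * real M) * (real M + 1/2 - \<sigma>)))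
        + 2 * pi * K * (exp ((real M + 1/2) * (- l)) * (2 * real M))) \<longlonglongrightarrow> 0"
      by (intro tendsto_add_zero tendsto_mult_right_zero)
    thus "(\<lambda>M. 2 * (4 * pi * K * exp (- \<eta> * real M) * (real M + 1/2 - \<sigma>))
        + 2 * pi * K * exp ((real M + 1/2) * (- l)) * (2 * real M)) \<longlonglongrightarrow> 0"
      by (simp only: mult.assoc)
  qed
  moreover have "(\<lambda>M. ?L M + 2 * of_real pi * (\<Sum>n<M. ?t n)) \<longlonglongrightarrow>
      lindelof_integral c a \<sigma> z + 2 * of_real pi * E_series c (- a) z"
    by (intro tendsto_intros L S)
  ultimately have "lindelof_integral c a \<sigma> z + 2 * of_real pi * E_series c (- a) z = 0"
    using LIMSEQ_unique by blast
  thus ?thesis by (simp add: eq_neg_iff_add_eq_0)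
qed

text \<open>In the variable \<open>w = Ln z\<close> the truncated integral is entire, by differentiation under the
  integral sign over a compact interval.\<close>
lemma holomorphic_truncated_lindelof_integral:
  assumes "0 < \<sigma>" "\<sigma> < 1"
  shows "(\<lambda>z. integral {- real M..real M} (\<lambda>t. lindelof_kernel c a z (Complex \<sigma> t))) holomorphic_on (- \<real>\<^sub>\<le>\<^sub>0)"
proof -
  define k where "k = (\<lambda>t. lindelof_kernel c a 1 (Complex \<sigma> t))"
  have k: "lindelof_kernel c a z (Complex \<sigma> t) = k t * exp (Complex \<sigma> t * Ln z)" for z t
    by (simp only: k_def lindelof_kernel_def Ln_1 mult_zero_right exp_zero mult_1_right)
  have kc: "continuous_on A k" for A
    unfolding k_def using continuous_on_lindelof_kernel_line[OF assms] continuous_on_subset by blast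
  have cc: "continuous_on A (Complex \<sigma>)" for A
    unfolding Complex_eq by (intro continuous_intros)
  have "(\<lambda>w. integral (cbox (- real M) (real M)) (\<lambda>t. k t * exp (Complex \<sigma> t * w))) holomorphic_on UNIV"
  proof (rule leibniz_rule_holomorphic[where fx = "\<lambda>w t. k t * (exp (Complex \<sigma> t * w) * Complex \<sigma> t)"])
    show "((\<lambda>w. k t * exp (Complex \<sigma> t * w)) has_field_derivative k t * (exp (Complex \<sigma> t * w) * Complex \<sigma> t)) (at w within UNIV)" for w t
      by (auto intro!: derivative_eq_intros)
    show "(\<lambda>t. k t * exp (Complex \<sigma> t * w)) integrable_on cbox (- real M) (real M)" for w
      by (intro integrable_continuous continuous_intros kc cc)
    have "continuous_on (UNIV \<times> cbox (- real M) (real M)) (\<lambda>p. k (snd p) * (exp (Complex \<sigma> (snd p) * fst p) * Complex \<sigma> (snd p)))"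
      by (intro continuous_intros continuous_on_compose2[OF kc[of UNIV]] continuous_on_compose2[OF cc[of UNIV]]) auto
    thus "continuous_on (UNIV \<times> cbox (- real M) (real M)) (\<lambda>(w, t). k t * (exp (Complex \<sigma> t * w) * Complex \<sigma> t))"
      by (simp add: case_prod_unfold)
  qed auto
  hence "((\<lambda>w. integral (cbox (- real M) (real M)) (\<lambda>t. k t * exp (Complex \<sigma> t * w))) \<circ> Ln) holomorphic_on (- \<real>\<^sub>\<le>\<^sub>0)"
    by (intro holomorphic_on_compose_gen[of Ln _ _ UNIV] holomorphic_on_Ln) auto
  thus ?thesis by (simp add: k o_def)
qed

text \<open>Near each point the modulus and argument of \<open>z\<close> stay in compact ranges, so the truncated
  integrals converge locally uniformly.\<close>
lemma holomorphic_lindelof_integral: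
  assumes "c > 0" "a > 0" "0 < \<sigma>" "\<sigma> < 1"
  shows "lindelof_integral c a \<sigma> holomorphic_on (- \<real>\<^sub>\<le>\<^sub>0)"
proof (rule holomorphic_uniform_sequence)
  show "open (- \<real>\<^sub>\<le>\<^sub>0 :: complex set)" by auto
  show "(\<lambda>z. integral {- real M..real M} (\<lambda>t. lindelof_kernel c a z (Complex \<sigma> t))) holomorphic_on (- \<real>\<^sub>\<le>\<^sub>0)" for M
    by (rule holomorphic_truncated_lindelof_integral[OF assms(3,4)])
  fix x :: complex assume "x \<in> - \<real>\<^sub>\<le>\<^sub>0"
  then obtain d where d: "d > 0" "cball x d \<subseteq> - \<real>\<^sub>\<le>\<^sub>0"
    using open_contains_cball[of "- \<real>\<^sub>\<le>\<^sub>0 :: complex set"] by auto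
  have ne: "cball x d \<noteq> {}" using d by auto
  have "continuous_on (cball x d) (\<lambda>z. \<bar>Im (Ln z)\<bar>)"
    using d by (intro continuous_intros) auto
  from continuous_attains_sup[OF compact_cball ne this]
  obtain y where y: "y \<in> cball x d" "\<And>z. z \<in> cball x d \<Longrightarrow> \<bar>Im (Ln z)\<bar> \<le> \<bar>Im (Ln y)\<bar>" by auto
  have "continuous_on (cball x d) (\<lambda>z. exp (\<sigma> * ln (cmod z)))"
    using d by (intro continuous_intros) auto
  from continuous_attains_sup[OF compact_cball ne this]
  obtain v where v: "\<And>z. z \<in> cball x d \<Longrightarrow> exp (\<sigma> * ln (cmod z)) \<le> exp (\<sigma> * ln (cmod v))" by blast
  define \<eta> where "\<eta> = pi - \<bar>Im (Ln y)\<bar>"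
  have eta: "\<eta> > 0" using Im_Ln_lt_pi[of y] y(1) d by (auto simp: \<eta>_def)
  define B where "B = 2 * pi / sin (pi * \<sigma>) * exp (c * \<sigma> powr (- a))"
  have B: "B > 0" using sin_pi_pos[OF assms(3,4)] by (simp add: B_def)
  have tail: "exp_tail \<eta> M \<ge> 0" for M unfolding exp_tail_def by (intro Bochner_Integration.integral_nonneg) auto
  let ?L = "\<lambda>M z. integral {- real M..real M} (\<lambda>t. lindelof_kernel c a z (Complex \<sigma> t))"
  have bd: "cmod (?L M z - lindelof_integral c a \<sigma> z) \<le> B * exp (\<sigma> * ln (cmod v)) * exp_tail \<eta> M" if "z \<in> cball x d" for z M
  proof -
    have "cmod (lindelof_integral c a \<sigma> z - ?L M z) \<le> B * exp (\<sigma> * ln (cmod z)) * exp_tail \<eta> M"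
      unfolding B_def by (rule lindelof_integral_truncation) (use assms that d y eta in \<open>auto simp: \<eta>_def\<close>)
    also have "\<dots> \<le> B * exp (\<sigma> * ln (cmod v)) * exp_tail \<eta> M"
      using v[OF that] B tail by (intro mult_right_mono mult_left_mono) auto
    finally show ?thesis by (simp add: norm_minus_commute)
  qed
  have "uniform_limit (cball x d) ?L (lindelof_integral c a \<sigma>) sequentially"
  proof (rule uniform_limitI)
    fix e :: real assume "e > 0"
    have "(\<lambda>M. B * exp (\<sigma> * ln (cmod v)) * exp_tail \<eta> M) \<longlonglongrightarrow> 0"
      by (intro tendsto_mult_right_zero exp_tail_tendsto_0 eta)
    hence "eventually (\<lambda>M. B * exp (\<sigma> * ln (cmod v)) * exp_tail \<eta> M < e) sequentially"
      using \<open>e > 0\<close> by (rule order_tendstoD)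
    thus "eventually (\<lambda>M. \<forall>z\<in>cball x d. dist (?L M z) (lindelof_integral c a \<sigma> z) < e) sequentially"
      by eventually_elim (use le_less_trans[OF bd] in \<open>simp add: dist_norm\<close>)
  qed
  thus "\<exists>d>0. cball x d \<subseteq> - \<real>\<^sub>\<le>\<^sub>0 \<and> uniform_limit (cball x d) ?L (lindelof_integral c a \<sigma>) sequentially"
    using d by blast
qed

lemma E_series_holomorphic:
  assumes "c > 0" "a > 0"
  shows "E_series c (- a) holomorphic_on ball 0 1"
proof (rule power_series_holomorphic)
  define b where "b n = (if n = 0 then 0 else of_real (exp (c * real n powr (- a))) * (- 1) ^ n :: complex)" for n
  fix z :: complex assume z: "z \<in> ball 0 1"
  let ?t = "\<lambda>n. of_real (exp (c * real (Suc n) powr (- a))) * (- z) ^ Suc n"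
  have "summable ?t"
    using z assms by (intro E_series_summable) auto
  hence "?t sums E_series c (- a) z" unfolding E_series_def by (rule summable_sums)
  moreover have "?t n = b (Suc n) * z ^ Suc n" for n
    by (simp add: b_def power_minus[of z])
  ultimately have "(\<lambda>n. b (Suc n) * z ^ Suc n) sums E_series c (- a) z" by simp
  from sums_Suc[OF this] have "(\<lambda>n. b n * z ^ n) sums E_series c (- a) z"
    by (simp add: b_def)
  thus "(\<lambda>n. b n * (z - 0) ^ n) sums E_series c (- a) z" by simp
qed

lemma slit_plane_eq: "slit_plane = ball 0 1 \<union> (- \<real>\<^sub>\<le>\<^sub>0)"
proof -
  have "z \<in> complex_of_real ` {..- 1} \<longleftrightarrow> z \<in> \<real>\<^sub>\<le>\<^sub>0 \<and> 1 \<le> cmod z" for z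
  proof
    assume "z \<in> complex_of_real ` {..- 1}"
    thus "z \<in> \<real>\<^sub>\<le>\<^sub>0 \<and> 1 \<le> cmod z" by auto
  next
    assume z: "z \<in> \<real>\<^sub>\<le>\<^sub>0 \<and> 1 \<le> cmod z"
    then obtain x where x: "z = of_real x" "x \<le> 0" by (auto elim: nonpos_Reals_cases)
    with z have "x \<le> - 1" by simp
    thus "z \<in> complex_of_real ` {..- 1}" using x by auto
  qed
  thus ?thesis unfolding slit_plane_def by (auto simp: not_le)
qed

lemma connected_minus_nonpos_Reals: "connected (- \<real>\<^sub>\<le>\<^sub>0 :: complex set)"
proof -
  have "(\<real>\<^sub>\<le>\<^sub>0 :: complex set) = complex_of_real ` {..0}"
    by (auto simp: nonpos_Reals_def)
  thus ?thesis using starlike_imp_connected[OF starlike_slotted_complex_plane_left[of 0]] by simp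
qed

text \<open>Gluing the series on the disc to the integral on the cut plane produces a continuation, so the
  choice that defines \<^const>\<open>E_fun\<close> is not void; the identity theorem then identifies whichever
  function was chosen.\<close>
lemma E_fun_eq_lindelof_integral:
  assumes "c > 0" "a > 0" "0 < \<sigma>" "\<sigma> < 1" "z \<notin> \<real>\<^sub>\<le>\<^sub>0"
  shows "E_fun c (- a) z = - lindelof_integral c a \<sigma> z / (2 * of_real pi)"
proof -
  define J where "J z = - lindelof_integral c a \<sigma> z / (2 * of_real pi)" for z
  have J: "J holomorphic_on (- \<real>\<^sub>\<le>\<^sub>0)"
    unfolding J_def by (intro holomorphic_intros holomorphic_lindelof_integral assms) auto
  have JE: "E_series c (- a) z = J z" if "z \<in> ball 0 1" "z \<in> - \<real>\<^sub>\<le>\<^sub>0" for z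
    unfolding J_def using lindelof_integral_eq_series[OF assms(1-4), of z] that by simp
  define f where "f = (\<lambda>z. if z \<in> ball 0 1 then E_series c (- a) z else J z)"
  have "f holomorphic_on slit_plane"
    unfolding f_def slit_plane_eq
    by (intro holomorphic_on_If_Un E_series_holomorphic assms J JE) auto
  moreover have "\<forall>z\<in>ball 0 1. f z = E_series c (- a) z" by (simp add: f_def)
  ultimately have ex: "\<exists>f. f holomorphic_on slit_plane \<and> (\<forall>z\<in>ball 0 1. f z = E_series c (- a) z)"
    by blast
  have E: "E_fun c (- a) holomorphic_on slit_plane" "\<And>z. z \<in> ball 0 1 \<Longrightarrow> E_fun c (- a) z = E_series c (- a) z"
    unfolding E_fun_def using someI_ex[OF ex] by blast+
  have "E_fun c (- a) z = J z"
  proof (rule analytic_continuation_open[where f = "E_fun c (- a)" and g = J and s = "ball 0 1 \<inter> (- \<real>\<^sub>\<le>\<^sub>0)" and s' = "- \<real>\<^sub>\<le>\<^sub>0"])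
    show "open (ball 0 1 \<inter> (- \<real>\<^sub>\<le>\<^sub>0) :: complex set)"
      by (intro open_Int open_ball open_Compl closed_nonpos_Reals_complex)
    have "(1 / 2 :: complex) \<in> ball 0 1 \<inter> (- \<real>\<^sub>\<le>\<^sub>0)" by (auto simp: complex_nonpos_Reals_iff)
    thus "ball 0 1 \<inter> (- \<real>\<^sub>\<le>\<^sub>0) \<noteq> ({} :: complex set)" by blast
    show "E_fun c (- a) holomorphic_on (- \<real>\<^sub>\<le>\<^sub>0)"
      using E(1) by (rule holomorphic_on_subset) (auto simp: slit_plane_eq)
    show "E_fun c (- a) z = J z" if "z \<in> ball 0 1 \<inter> (- \<real>\<^sub>\<le>\<^sub>0)" for z
      using that E(2) JE by auto
  qed (use assms J connected_minus_nonpos_Reals in auto)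
  thus ?thesis by (simp add: J_def)
qed

section \<open>Laplace's method on the vertical line through the saddle\<close>
definition abs_moment :: "nat \<Rightarrow> real" where
  "abs_moment k = (LINT x|lborel. std_normal_density x * \<bar>x\<bar> ^ k)"

lemma scaled_std_normal_moment:
  assumes "q > 0"
  shows "integrable lborel (\<lambda>y. \<bar>y\<bar> ^ k * exp (- (q * y)\<^sup>2 / 2))"
    and "(LINT y|lborel. \<bar>y\<bar> ^ k * exp (- (q * y)\<^sup>2 / 2)) = sqrt (2 * pi) * abs_moment k / q ^ Suc k"
proof -
  let ?f = "\<lambda>x. std_normal_density x * \<bar>x\<bar> ^ k"
  have f: "?f (0 + q * y) = q ^ k / sqrt (2 * pi) * (\<bar>y\<bar> ^ k * exp (- (q * y)\<^sup>2 / 2))" for y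
    using assms by (simp add: std_normal_density_def abs_mult power_mult_distrib)
  have "integrable lborel (\<lambda>y. ?f (0 + q * y))"
    using assms by (intro lborel_integrable_real_affine integrable_std_normal_moment_abs) auto
  hence "integrable lborel (\<lambda>y. sqrt (2 * pi) / q ^ k * ?f (0 + q * y))"
    by (rule integrable_mult_right)
  also have "(\<lambda>y. sqrt (2 * pi) / q ^ k * ?f (0 + q * y)) = (\<lambda>y. \<bar>y\<bar> ^ k * exp (- (q * y)\<^sup>2 / 2))"
    unfolding f using assms by (intro ext) simp
  finally show "integrable lborel (\<lambda>y. \<bar>y\<bar> ^ k * exp (- (q * y)\<^sup>2 / 2))" .
  have "abs_moment k = \<bar>q\<bar> *\<^sub>R (LINT y|lborel. ?f (0 + q * y))"
    unfolding abs_moment_def using assms by (intro lborel_integral_real_affine) auto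
  also have "\<dots> = q * (q ^ k / sqrt (2 * pi) * (LINT y|lborel. \<bar>y\<bar> ^ k * exp (- (q * y)\<^sup>2 / 2)))"
    unfolding f using assms by simp
  finally show "(LINT y|lborel. \<bar>y\<bar> ^ k * exp (- (q * y)\<^sup>2 / 2)) = sqrt (2 * pi) * abs_moment k / q ^ Suc k"
    using assms by (simp add: field_simps)
qed

lemma abs_moment_0: "abs_moment 0 = 1"
  using integral_std_normal_moment_even[of 0] by (simp add: abs_moment_def)

lemma gaussian_abs_moment:
  assumes "b > 0"
  shows "integrable lborel (\<lambda>y. \<bar>y\<bar> ^ k * exp (- b * y\<^sup>2))"
    and "(LINT y|lborel. \<bar>y\<bar> ^ k * exp (- b * y\<^sup>2)) = sqrt (2 * pi) * abs_moment k / sqrt (2 * b) ^ Suc k"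
proof -
  have "- (sqrt (2 * b) * y)\<^sup>2 / 2 = - b * y\<^sup>2" for y
    using assms by (simp add: power_mult_distrib)
  thus "integrable lborel (\<lambda>y. \<bar>y\<bar> ^ k * exp (- b * y\<^sup>2))"
    and "(LINT y|lborel. \<bar>y\<bar> ^ k * exp (- b * y\<^sup>2)) = sqrt (2 * pi) * abs_moment k / sqrt (2 * b) ^ Suc k"
    using scaled_std_normal_moment[of "sqrt (2 * b)" k] assms by simp_all
qed

lemma powr_neg_le_linear:
  fixes u p :: real
  assumes "0 \<le> u" "u \<le> 1" "p > 0"
  shows "(1 + u) powr (- p) \<le> 1 - p * u / (2 + p)"
proof -
  have "u / (1 + u) \<le> ln (1 + u)"
    using ln_add_one_self_le_self2[of "- u / (1 + u)"] ln_one_minus_pos_upper_bound[of "u / (1 + u)"] assms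
      ln_inverse[of "1 + u"]
    by (simp add: field_simps)
  moreover have "u / 2 \<le> u / (1 + u)"
    using assms by (intro divide_left_mono) auto
  ultimately have l: "u / 2 \<le> ln (1 + u)" by linarith
  define v where "v = p * u / 2"
  have v: "0 \<le> v" "v \<le> p / 2" using assms by (auto simp: v_def mult_left_le)
  have "(1 + u) powr (- p) = exp (- (p * ln (1 + u)))" using assms by (simp add: powr_def)
  also have "\<dots> \<le> exp (- v)" using l assms(3) by (simp add: v_def)
  also have "\<dots> = 1 / exp v" by (simp add: exp_minus field_simps)
  also have "\<dots> \<le> 1 / (1 + v)" using v exp_ge_add_one_self[of v] by (intro divide_left_mono) auto
  also have "\<dots> = 1 - v / (1 + v)" using v by (simp add: field_simps)
  also have "\<dots> \<le> 1 - v / (1 + p / 2)" using v by (intro diff_left_mono divide_left_mono) auto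
  also have "v / (1 + p / 2) = p * u / (2 + p)" using assms by (simp add: v_def field_simps)
  finally show ?thesis .
qed

lemma norm_one_plus_iy: "cmod (1 + \<i> * of_real y) = sqrt (1 + y\<^sup>2)"
  by (simp add: cmod_def)

text \<open>With \<open>s = \<sigma> (1 + \<i> y)\<close> and \<open>N = a c \<sigma>\<^sup>-\<^sup>a = \<sigma> l\<close>, the exponent \<open>c s\<^sup>-\<^sup>a + s l\<close> equals its
  value \<open>N (1 + 1/a)\<close> at the saddle plus \<open>N\<close> times this function.\<close>
definition saddle_exponent :: "real \<Rightarrow> real \<Rightarrow> complex" where
  "saddle_exponent a y = ((1 + \<i> * of_real y) powr of_real (- a) - 1) / of_real a + \<i> * of_real y"

text \<open>Quadratic decay near the saddle and a uniform gap away from it, both from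
  \<open>\<bar>(1 + \<i> y)\<^sup>-\<^sup>a\<bar> = (1 + y\<^sup>2)\<^sup>-\<^sup>a\<^sup>/\<^sup>2\<close>.\<close>
lemma Re_saddle_exponent_le:
  fixes a y :: real
  assumes "a > 0"
  shows "Re (saddle_exponent a y) \<le> - min 1 (y\<^sup>2) / (4 + a)"
proof -
  let ?u = "min 1 (y\<^sup>2)"
  have "Re ((1 + \<i> * of_real y) powr of_real (- a)) \<le> cmod ((1 + \<i> * of_real y) powr of_real (- a))"
    by (rule complex_Re_le_cmod)
  also have "\<dots> = sqrt (1 + y\<^sup>2) powr (- a)"
    by (simp add: norm_powr_real_powr' norm_one_plus_iy)
  also have "\<dots> = (1 + y\<^sup>2) powr (- (a / 2))"
    by (simp add: powr_half_sqrt[symmetric] powr_powr add_nonneg_nonneg)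
  also have "\<dots> \<le> (1 + ?u) powr (- (a / 2))"
    using assms by (intro powr_mono2') (auto simp: min_def add_pos_nonneg)
  also have "\<dots> \<le> 1 - (a / 2) * ?u / (2 + a / 2)"
    using assms by (intro powr_neg_le_linear) auto
  also have "(a / 2) * ?u / (2 + a / 2) = a * (?u / (4 + a))"
    using assms by (simp add: field_simps)
  finally have "(Re ((1 + \<i> * of_real y) powr of_real (- a)) - 1) / a \<le> - (?u / (4 + a))"
    using assms by (simp add: divide_le_eq mult.commute)
  thus ?thesis by (simp add: saddle_exponent_def)
qed

text \<open>The linear terms cancel, as they must at a saddle. The estimate holds for all \<open>y\<close> because the
  third derivative of \<open>s\<^sup>-\<^sup>a\<close> is bounded on the half-plane \<open>Re s \<ge> 1\<close>.\<close>
lemma saddle_exponent_Taylor: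
  fixes a y :: real
  assumes "a > 0"
  shows "cmod (saddle_exponent a y + of_real ((a + 1) * y\<^sup>2 / 2))
    \<le> (a + 1) * (a + 2) / 2 * \<bar>y\<bar> ^ 3"
proof -
  define f where "f = (\<lambda>i s. of_real (\<Prod>j<i. - a - real j) * s powr (of_real (- a - real i) :: complex))"
  let ?S = "{s. 1 \<le> Re s}"
  let ?z = "1 + \<i> * of_real y"
  have "cmod (f 0 ?z - (\<Sum>i\<le>2. f i 1 * (?z - 1) ^ i / fact i)) \<le> (a * (a + 1) * (a + 2)) * cmod (?z - 1) ^ Suc 2 / fact 2"
  proof (rule complex_Taylor)
    show "convex ?S" by (rule convex_halfspace_Re_ge)
    show "(f i has_field_derivative f (Suc i) s) (at s within ?S)" if "s \<in> ?S" for i s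
    proof -
      have s: "s \<notin> \<real>\<^sub>\<le>\<^sub>0" using that by (auto simp: complex_nonpos_Reals_iff)
      have e: "of_real (- a - real i) - 1 = (of_real (- a - real (Suc i)) :: complex)" by simp
      have "(f i has_field_derivative
          of_real (\<Prod>j<i. - a - real j) * (of_real (- a - real i) * s powr (of_real (- a - real i) - 1))) (at s within ?S)"
        unfolding f_def
        by (rule has_field_derivative_at_within, rule DERIV_cmult, rule has_field_derivative_powr[OF s])
      thus ?thesis unfolding e by (simp only: f_def prod.lessThan_Suc of_real_mult mult.assoc)
    qed
    show "cmod (f (Suc 2) s) \<le> a * (a + 1) * (a + 2)" if "s \<in> ?S" for s
    proof -
      have "1 \<le> cmod s" using that complex_Re_le_cmod[of s] by simp
      hence "cmod s powr (- a - 3) \<le> 1" using assms powr_mono2'[of "- a - 3" 1 "cmod s"] by simp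
      moreover have "\<bar>\<Prod>j<3. - a - real j\<bar> = a * (a + 1) * (a + 2)"
        using assms by (simp add: eval_nat_numeral abs_mult) (simp add: algebra_simps)
      moreover have "cmod (f (Suc 2) s) = \<bar>\<Prod>j<3. - a - real j\<bar> * cmod s powr (- a - 3)"
      proof -
        have "cmod (s powr of_real (- a - real 3)) = cmod s powr (- a - real 3)"
          by (subst norm_powr_real_powr') simp_all
        thus ?thesis by (simp only: f_def norm_mult norm_of_real Suc_eq_plus1) simp
      qed
      ultimately show ?thesis using assms by (simp add: mult_left_le)
    qed
  qed auto
  moreover have "f 0 ?z - (\<Sum>i\<le>2. f i 1 * (?z - 1) ^ i / fact i)
      = of_real a * (saddle_exponent a y + of_real ((a + 1) * y\<^sup>2 / 2))"
    using assms by (simp add: saddle_exponent_def f_def eval_nat_numeral field_simps)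
  moreover have "cmod (?z - 1) = \<bar>y\<bar>" by (simp add: norm_mult)
  ultimately have "a * cmod (saddle_exponent a y + of_real ((a + 1) * y\<^sup>2 / 2))
     \<le> a * ((a + 1) * (a + 2) / 2 * \<bar>y\<bar> ^ 3)"
    using assms by (simp only: norm_mult norm_of_real) (simp add: mult_ac eval_nat_numeral)
  thus ?thesis using assms by (simp only: mult_le_cancel_left_pos)
qed

lemma norm_exp_diff_le:
  assumes "Re A \<le> m" "Re B \<le> m"
  shows "cmod (exp A - exp B) \<le> exp m * cmod (A - B)"
proof (rule field_differentiable_bound[where S = "{s. Re s \<le> m}" and f' = exp])
  show "(exp has_field_derivative exp z) (at z within {s. Re s \<le> m})" for z :: complex
    by (auto intro!: derivative_eq_intros)
qed (use assms in \<open>auto simp: convex_halfspace_Re_le\<close>)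

text \<open>Here \<open>w\<close> stands for the value at \<open>y\<close> of a factor that is close to 1 near the saddle and decays
  slowly along the line. For \<open>\<bar>y\<bar> \<le> 1\<close> the difference to the Gaussian is controlled by the Taylor
  expansion and carries the Gaussian weight. For \<open>\<bar>y\<bar> > 1\<close> the gap makes the integrand exponentially
  small in \<open>N\<close>, and the decay of \<open>w\<close> is kept to make it integrable.\<close>
lemma laplace_integrand_bound:
  fixes a \<eta> B N \<sigma> y :: real and w :: complex
  assumes "a > 0" "B \<ge> 0" "N > 0" "\<sigma> > 0"
    and w: "cmod w \<le> B * exp (- \<eta> * \<sigma> * \<bar>y\<bar>)" "cmod w \<le> B"
    and w1: "\<bar>y\<bar> \<le> 1 \<Longrightarrow> cmod (w - 1) \<le> B * \<sigma>"
  defines "\<kappa> \<equiv> 1 / (4 + a)" and "K \<equiv> (a + 1) * (a + 2) / 2 * B + B + 1"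
  shows "cmod (exp (of_real N * saddle_exponent a y) * w / (1 + \<i> * of_real y) - of_real (exp (- (N * (a + 1) / 2) * y\<^sup>2)))
     \<le> K * (N * \<bar>y\<bar> ^ 3 + \<bar>y\<bar> + \<sigma>) * exp (- (\<kappa> * N) * y\<^sup>2) + K * exp (- \<kappa> * N) * exp (- \<eta> * \<sigma> * \<bar>y\<bar>)"
proof -
  define A where "A = of_real N * saddle_exponent a y"
  define E where "E = complex_of_real (- (N * (a + 1) / 2) * y\<^sup>2)"
  define C where "C = (a + 1) * (a + 2) / 2"
  have C: "C \<ge> 0" using assms(1) by (simp add: C_def)
  have K: "K \<ge> B" "K \<ge> 1" "K \<ge> C * B" using assms(2) C by (auto simp: K_def C_def)
  have n1: "cmod (1 + \<i> * of_real y) \<ge> 1" by (simp add: norm_one_plus_iy)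
  have ne: "1 + \<i> * of_real y \<noteq> 0" using n1 by auto
  have "\<kappa> * 1 \<le> 1 / 2 * (a + 1)"
  proof -
    have "\<kappa> \<le> 1/2" using assms(1) by (simp add: \<kappa>_def)
    thus ?thesis using assms(1) by simp
  qed
  hence "(N * y\<^sup>2) * \<kappa> \<le> (N * y\<^sup>2) * (1 / 2 * (a + 1))"
    using assms(3) by (intro mult_left_mono) auto
  hence ReE: "Re E \<le> - (\<kappa> * N) * y\<^sup>2" by (simp add: E_def algebra_simps)
  have EE: "complex_of_real (exp (- (N * (a + 1) / 2) * y\<^sup>2)) = exp E"
    unfolding E_def by (rule exp_of_real[symmetric])
  have ReA: "Re A \<le> - (\<kappa> * N) * min 1 (y\<^sup>2)"
  proof -
    have "Re A = N * Re (saddle_exponent a y)" by (simp add: A_def)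
    also have "\<dots> \<le> N * (- min 1 (y\<^sup>2) / (4 + a))"
      by (intro mult_left_mono Re_saddle_exponent_le assms(1)) (use assms(3) in auto)
    finally show ?thesis by (simp add: \<kappa>_def)
  qed
  show ?thesis
  proof (cases "\<bar>y\<bar> \<le> 1")
    case True
    hence "y\<^sup>2 \<le> 1" by (simp add: abs_square_le_1)
    hence ReA': "Re A \<le> - (\<kappa> * N) * y\<^sup>2" using ReA by simp
    have "A - E = of_real N * (saddle_exponent a y + of_real ((a + 1) * y\<^sup>2 / 2))"
      by (simp add: A_def E_def algebra_simps)
    hence "cmod (A - E) = N * cmod (saddle_exponent a y + of_real ((a + 1) * y\<^sup>2 / 2))"
      using assms(3) by (simp add: norm_mult)
    also have "\<dots> \<le> N * (C * \<bar>y\<bar> ^ 3)"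
      using saddle_exponent_Taylor[OF assms(1), of y] assms(3)
      by (intro mult_left_mono) (auto simp: C_def)
    finally have AE: "cmod (A - E) \<le> N * (C * \<bar>y\<bar> ^ 3)" .
    (* The exponential is Lipschitz with constant exp m on the half-plane Re \<le> m that contains A and E. *)
    have e1: "cmod (exp A - exp E) \<le> exp (- (\<kappa> * N) * y\<^sup>2) * (N * (C * \<bar>y\<bar> ^ 3))"
      by (rule order_trans[OF norm_exp_diff_le[OF ReA' ReE]]) (intro mult_left_mono AE, auto)
    have e2: "cmod (w / (1 + \<i> * of_real y)) \<le> B"
    proof -
      have "cmod w / cmod (1 + \<i> * of_real y) \<le> B / 1"
        using w(2) n1 assms(2) by (intro frac_le) auto
      thus ?thesis by (simp add: norm_divide)
    qed
    have e3: "cmod (w / (1 + \<i> * of_real y) - 1) \<le> B * \<sigma> + \<bar>y\<bar>"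
    proof -
      have "w / (1 + \<i> * of_real y) - 1 = ((w - 1) - \<i> * of_real y) / (1 + \<i> * of_real y)"
        using ne by (simp add: field_simps)
      hence "cmod (w / (1 + \<i> * of_real y) - 1) = cmod ((w - 1) - \<i> * of_real y) / cmod (1 + \<i> * of_real y)"
        by (simp add: norm_divide)
      also have "\<dots> \<le> (B * \<sigma> + \<bar>y\<bar>) / 1"
      proof (rule frac_le)
        have "cmod ((w - 1) - \<i> * of_real y) \<le> cmod (w - 1) + cmod (\<i> * of_real y)"
          by (rule norm_triangle_ineq4)
        thus "cmod ((w - 1) - \<i> * of_real y) \<le> B * \<sigma> + \<bar>y\<bar>"
          using w1[OF True] by (simp add: norm_mult)
      qed (use n1 assms(2,4) in auto)
      finally show ?thesis by simp
    qed
    have "exp A * w / (1 + \<i> * of_real y) - exp E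
        = (exp A - exp E) * (w / (1 + \<i> * of_real y)) + exp E * (w / (1 + \<i> * of_real y) - 1)"
      by (simp add: algebra_simps diff_divide_distrib)
    hence "cmod (exp A * w / (1 + \<i> * of_real y) - exp E)
        \<le> cmod (exp A - exp E) * cmod (w / (1 + \<i> * of_real y)) + cmod (exp E) * cmod (w / (1 + \<i> * of_real y) - 1)"
      by (metis norm_mult norm_triangle_ineq)
    also have "\<dots> \<le> (exp (- (\<kappa> * N) * y\<^sup>2) * (N * (C * \<bar>y\<bar> ^ 3))) * B + exp (- (\<kappa> * N) * y\<^sup>2) * (B * \<sigma> + \<bar>y\<bar>)"
      using e1 e2 e3 ReE assms(2,3) C by (intro add_mono mult_mono) auto
    also have "\<dots> = ((C * B) * (N * \<bar>y\<bar> ^ 3) + B * \<sigma> + 1 * \<bar>y\<bar>) * exp (- (\<kappa> * N) * y\<^sup>2)"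
      by (simp add: algebra_simps)
    also have "\<dots> \<le> (K * (N * \<bar>y\<bar> ^ 3) + K * \<sigma> + K * \<bar>y\<bar>) * exp (- (\<kappa> * N) * y\<^sup>2)"
      using K assms(3,4) by (intro mult_right_mono add_mono) auto
    also have "\<dots> = K * (N * \<bar>y\<bar> ^ 3 + \<bar>y\<bar> + \<sigma>) * exp (- (\<kappa> * N) * y\<^sup>2)"
      by (simp add: algebra_simps)
    also have "\<dots> \<le> \<dots> + K * exp (- \<kappa> * N) * exp (- \<eta> * \<sigma> * \<bar>y\<bar>)"
      using K by simp
    finally show ?thesis unfolding EE A_def .
  next
    case False
    hence y2: "1 \<le> y\<^sup>2" by (meson abs_square_le_1 linear not_le)
    have "cmod (exp A * w / (1 + \<i> * of_real y)) = exp (Re A) * (cmod w / cmod (1 + \<i> * of_real y))"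
      by (simp add: norm_divide norm_mult)
    also have "\<dots> \<le> exp (- \<kappa> * N) * (B * exp (- \<eta> * \<sigma> * \<bar>y\<bar>) / 1)"
      using ReA y2 w n1 assms(2) by (intro mult_mono frac_le) auto
    also have "\<dots> \<le> K * exp (- \<kappa> * N) * exp (- \<eta> * \<sigma> * \<bar>y\<bar>)"
      using K by (simp add: mult_ac)
    finally have 1: "cmod (exp A * w / (1 + \<i> * of_real y)) \<le> K * exp (- \<kappa> * N) * exp (- \<eta> * \<sigma> * \<bar>y\<bar>)" .
    have "cmod (exp E) \<le> 1 * 1 * exp (- (\<kappa> * N) * y\<^sup>2)" using ReE by simp
    also have "\<dots> \<le> K * (N * \<bar>y\<bar> ^ 3 + \<bar>y\<bar> + \<sigma>) * exp (- (\<kappa> * N) * y\<^sup>2)"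
    proof (intro mult_right_mono mult_mono)
      have "0 \<le> N * \<bar>y\<bar> ^ 3" using assms(3) by simp
      thus "1 \<le> N * \<bar>y\<bar> ^ 3 + \<bar>y\<bar> + \<sigma>" using False assms(4) by linarith
    qed (use K in auto)
    finally have 2: "cmod (exp E) \<le> K * (N * \<bar>y\<bar> ^ 3 + \<bar>y\<bar> + \<sigma>) * exp (- (\<kappa> * N) * y\<^sup>2)" .
    show ?thesis
      unfolding EE A_def[symmetric]
      by (rule order_trans[OF norm_triangle_ineq4]) (use 1 2 in linarith)
  qed
qed

text \<open>Integrating the pointwise bound: the terms \<open>N \<bar>y\<bar>\<^sup>3\<close> and \<open>\<bar>y\<bar>\<close> both have Gaussian integral of
  order \<open>1 / N\<close>, the constant \<open>\<sigma>\<close> gives \<open>\<sigma> / \<surd>N\<close>, and the far part costs the length \<open>1 / \<sigma>\<close> of the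
  range on which \<open>w\<close> is not yet small. The constant is uniform in \<open>N\<close>, \<open>\<sigma>\<close> and \<open>w\<close>, since all
  three change with \<open>z\<close>.\<close>
lemma laplace_estimate:
  fixes a \<eta> B :: real
  assumes "a > 0" "B \<ge> 0" "\<eta> > 0"
  shows "\<exists>C. \<forall>N>0. \<forall>\<sigma>>0. \<forall>w. continuous_on UNIV w \<longrightarrow>
     (\<forall>y. cmod (w y) \<le> B * exp (- \<eta> * \<sigma> * \<bar>y\<bar>)) \<longrightarrow>
     (\<forall>y. \<bar>y\<bar> \<le> 1 \<longrightarrow> cmod (w y - 1) \<le> B * \<sigma>) \<longrightarrow>
     cmod ((LINT y|lborel. exp (of_real N * saddle_exponent a y) * w y / (1 + \<i> * of_real y))
        - of_real (sqrt (2 * pi / (N * (a + 1)))))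
     \<le> C * (1 / N + \<sigma> / sqrt N + exp (- N / (4 + a)) / \<sigma>)"
proof -
  define \<kappa> K where "\<kappa> = 1 / (4 + a)" and "K = (a + 1) * (a + 2) / 2 * B + B + 1"
  define T where "T = (LINT y|lborel. exp (- \<eta> * \<bar>y::real\<bar>))"
  define C1 where "C1 = sqrt (2 * pi) * abs_moment 3 / sqrt (2 * \<kappa>) ^ 4 + sqrt (2 * pi) * abs_moment 1 / sqrt (2 * \<kappa>) ^ 2"
  define C2 where "C2 = sqrt (2 * pi) / sqrt (2 * \<kappa>)"
  define C where "C = K * (\<bar>C1\<bar> + C2 + T)"
  have kap: "\<kappa> > 0" using assms(1) by (simp add: \<kappa>_def)
  have K: "K > 0" using assms(1,2) by (simp add: K_def add_nonneg_pos)
  have T: "T \<ge> 0" unfolding T_def by (intro Bochner_Integration.integral_nonneg) auto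
  have C2: "C2 \<ge> 0" using kap by (simp add: C2_def)
  have "cmod ((LINT y|lborel. exp (of_real N * saddle_exponent a y) * w y / (1 + \<i> * of_real y))
        - of_real (sqrt (2 * pi / (N * (a + 1)))))
     \<le> C * (1 / N + \<sigma> / sqrt N + exp (- N / (4 + a)) / \<sigma>)"
    if N: "N > 0" and sg: "\<sigma> > 0" and w: "continuous_on UNIV w" "\<And>y. cmod (w y) \<le> B * exp (- \<eta> * \<sigma> * \<bar>y\<bar>)"
      "\<And>y. \<bar>y\<bar> \<le> 1 \<Longrightarrow> cmod (w y - 1) \<le> B * \<sigma>" for N \<sigma> :: real and w :: "real \<Rightarrow> complex"
  proof -
    let ?D = "\<lambda>y. exp (of_real N * saddle_exponent a y) * w y / (1 + \<i> * of_real y)"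
    let ?G = "\<lambda>y. exp (- (N * (a + 1) / 2) * y\<^sup>2)"
    let ?g = "\<lambda>k y. \<bar>y\<bar> ^ k * exp (- (\<kappa> * N) * y\<^sup>2)"
    let ?R = "\<lambda>y. K * (N * ?g 3 y + ?g 1 y + \<sigma> * ?g 0 y) + K * exp (- \<kappa> * N) * exp (- (\<eta> * \<sigma>) * \<bar>y\<bar>)"
    have kN: "\<kappa> * N > 0" using kap N by simp
    have b: "N * (a + 1) / 2 > 0" using N assms(1) by simp
    have es: "\<eta> * \<sigma> > 0" using assms(3) sg by simp
    have bound: "cmod (?D y - of_real (?G y)) \<le> ?R y" for y
    proof -
      have wB: "cmod (w y) \<le> B"
        using w(2)[of y] mult_left_mono[of "exp (- \<eta> * \<sigma> * \<bar>y\<bar>)" 1 B] assms(2) es by simp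
      show ?thesis
        using laplace_integrand_bound[OF assms(1,2) N sg w(2) wB w(3)]
        unfolding \<kappa>_def[symmetric] K_def[symmetric] by (simp add: algebra_simps)
    qed
    have g: "integrable lborel (?g k)" for k by (rule gaussian_abs_moment(1)[OF kN])
    have e: "integrable lborel (\<lambda>y. exp (- (\<eta> * \<sigma>) * \<bar>y\<bar>))" by (rule integrable_exp_abs[OF es])
    have R: "integrable lborel ?R"
      by (intro Bochner_Integration.integrable_add integrable_mult_right g e)
    have Gi: "integrable lborel ?G" using gaussian_abs_moment(1)[OF b, of 0] by simp
    have Gc: "integrable lborel (\<lambda>y. complex_of_real (?G y))" using Gi by (rule integrable_of_real)
    have Gv: "(LINT y|lborel. ?G y) = sqrt (2 * pi / (N * (a + 1)))"
      using gaussian_abs_moment(2)[OF b, of 0] by (simp add: abs_moment_0 real_sqrt_divide)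
    have ne: "1 + \<i> * complex_of_real y \<noteq> 0" for y by (simp add: complex_eq_iff)
    have nr: "1 + \<i> * complex_of_real y \<notin> \<real>\<^sub>\<le>\<^sub>0" for y by (simp add: complex_nonpos_Reals_iff)
    have "continuous_on UNIV ?D"
      unfolding saddle_exponent_def using assms(1) ne nr by (intro continuous_intros w(1)) auto
    hence Dm: "?D \<in> borel_measurable lborel" by (simp add: borel_measurable_continuous_onI)
    have diff: "integrable lborel (\<lambda>y. ?D y - of_real (?G y))"
    proof (rule Bochner_Integration.integrable_bound[OF R])
      show "(\<lambda>y. ?D y - of_real (?G y)) \<in> borel_measurable lborel"
        using Dm borel_measurable_integrable[OF Gc] by (rule borel_measurable_diff)
      show "AE y in lborel. norm (?D y - of_real (?G y)) \<le> norm (?R y)"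
        by (rule AE_I2, rule order_trans[OF bound]) simp
    qed
    from Bochner_Integration.integrable_add[OF diff Gc] have Di: "integrable lborel ?D" by simp
    have gv: "(LINT y|lborel. ?g k y) = sqrt (2 * pi) * abs_moment k / sqrt (2 * \<kappa>) ^ Suc k / sqrt N ^ Suc k" for k
      using gaussian_abs_moment(2)[OF kN, of k]
      by (simp add: real_sqrt_mult power_mult_distrib mult.assoc[symmetric])
    have ev: "(LINT y|lborel. exp (- (\<eta> * \<sigma>) * \<bar>y\<bar>)) = T / \<sigma>"
    proof -
      have "T = \<bar>\<sigma>\<bar> *\<^sub>R (LINT y|lborel. exp (- \<eta> * \<bar>0 + \<sigma> * y\<bar>))"
        unfolding T_def using sg by (intro lborel_integral_real_affine) auto
      thus ?thesis using sg by (simp add: abs_mult mult.assoc field_simps)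
    qed
    have s4: "sqrt N ^ 4 = N * N" using N
      by (simp add: eval_nat_numeral mult.assoc[symmetric])
    define I where "I k = sqrt (2 * pi) * abs_moment k / sqrt (2 * \<kappa>) ^ Suc k / sqrt N ^ Suc k" for k
    have hg: "has_bochner_integral lborel (?g k) (I k)" for k
      using g gv unfolding has_bochner_integral_iff I_def by blast
    have he: "has_bochner_integral lborel (\<lambda>y. exp (- (\<eta> * \<sigma>) * \<bar>y\<bar>)) (T / \<sigma>)"
      using e ev unfolding has_bochner_integral_iff by blast
    have Rv: "(LINT y|lborel. ?R y) = K * (N * I 3 + I 1 + \<sigma> * I 0) + K * exp (- \<kappa> * N) * (T / \<sigma>)"
      by (rule has_bochner_integral_integral_eq)
         (intro has_bochner_integral_add has_bochner_integral_mult_right hg he)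
    have eq: "(LINT y|lborel. ?D y) - of_real (sqrt (2 * pi / (N * (a + 1)))) = (LINT y|lborel. ?D y - of_real (?G y))"
      unfolding Bochner_Integration.integral_diff[OF Di Gc] by (simp only: integral_complex_of_real Gv)
    have I3: "N * I 3 = sqrt (2 * pi) * abs_moment 3 / sqrt (2 * \<kappa>) ^ 4 / N"
    proof -
      have "sqrt N ^ Suc 3 = N * N" "Suc 3 = 4" using s4 by simp_all
      thus ?thesis using N by (simp add: I_def)
    qed
    have I1: "I 1 = sqrt (2 * pi) * abs_moment 1 / sqrt (2 * \<kappa>) ^ 2 / N"
      using N by (simp add: I_def power2_eq_square)
    have I0: "I 0 = C2 / sqrt N"
      by (simp add: I_def C2_def abs_moment_0)
    have "cmod ((LINT y|lborel. ?D y) - of_real (sqrt (2 * pi / (N * (a + 1)))))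
        \<le> K * (N * I 3 + I 1 + \<sigma> * I 0) + K * exp (- \<kappa> * N) * (T / \<sigma>)"
      unfolding eq Rv[symmetric]
      by (rule Bochner_Integration.integral_norm_bound_integral[OF diff R]) (rule bound)
    also have "\<dots> = K * (C1 / N + C2 * (\<sigma> / sqrt N)) + K * exp (- \<kappa> * N) * (T / \<sigma>)"
      unfolding I3 I1 I0 C1_def by (simp add: add_divide_distrib)
    also have "\<dots> \<le> K * (\<bar>C1\<bar> * (1 / N) + C2 * (\<sigma> / sqrt N)) + K * exp (- \<kappa> * N) * (T / \<sigma>)"
      using K N by (intro add_right_mono mult_left_mono) (auto simp: divide_right_mono)
    also have "\<dots> = K * \<bar>C1\<bar> * (1 / N) + K * C2 * (\<sigma> / sqrt N) + K * T * (exp (- \<kappa> * N) / \<sigma>)"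
      by (simp add: algebra_simps)
    also have "\<dots> \<le> C * (1 / N) + C * (\<sigma> / sqrt N) + C * (exp (- \<kappa> * N) / \<sigma>)"
      using K C2 T N sg by (intro add_mono mult_right_mono) (auto simp: C_def)
    also have "\<dots> = C * (1 / N + \<sigma> / sqrt N + exp (- N / (4 + a)) / \<sigma>)"
      by (simp add: \<kappa>_def algebra_simps)
    finally show ?thesis .
  qed
  thus ?thesis by blast
qed

section \<open>The cosecant factor\<close>

text \<open>The mean value theorem gives \<open>sin u \<ge> u cos u\<close>, and \<open>cos \<ge> 1/2\<close> on this range.\<close>
lemma half_le_sin:
  fixes u :: real
  assumes "0 \<le> u" "u \<le> pi / 3" shows "u / 2 \<le> sin u"
proof -
  have "\<exists>v. 0 \<le> v \<and> v \<le> u \<and> sin u - sin 0 = (u - 0) * cos v" if "u \<noteq> 0"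
    using MVT2[of 0 u sin cos] that assms(1) by (auto simp: less_eq_real_def)
  then obtain v where v: "0 \<le> v" "v \<le> u" "sin u = u * cos v" by force
  have "1 / 2 \<le> cos v"
    using cos_monotone_0_pi_le[of v "pi / 3"] v assms cos_60 by auto
  thus ?thesis using v(3) mult_left_mono[of "1/2" "cos v" u] assms(1) by simp
qed

lemma times_exp_le_sinh:
  fixes v :: real
  assumes "v \<ge> 0" shows "v * exp v \<le> (1 + 2 * v) * sinh v"
proof -
  have "0 \<le> exp (2 * v) - 1 - 2 * v"
    using exp_ge_add_one_self[of "2 * v"] by linarith
  hence "0 \<le> exp (- v) * (exp (2 * v) - 1 - 2 * v)"
    by (intro mult_nonneg_nonneg) auto
  also have "\<dots> = exp v - exp (- v) - 2 * v * exp (- v)"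
    by (simp add: right_diff_distrib flip: exp_add)
  finally show ?thesis by (simp add: sinh_field_def field_simps)
qed

text \<open>Real and imaginary part of \<open>s\<close> in the numerator are absorbed by different lower bounds for the
  sine, so that the bound stays finite as \<open>s\<close> tends to 0.\<close>
lemma norm_cosecant_kernel_le:
  assumes "0 < Re s" "Re s \<le> 1/3"
  shows "cmod (of_real pi * s / sin (of_real pi * s)) \<le> (5 + 2 * pi * \<bar>Im s\<bar>) * exp (- pi * \<bar>Im s\<bar>)"
proof -
  define v where "v = pi * \<bar>Im s\<bar>"
  define d where "d = cmod (sin (of_real pi * s))"
  have v: "v \<ge> 0" by (simp add: v_def)
  have sx: "pi * Re s / 2 \<le> sin (pi * Re s)" using assms by (intro half_le_sin) auto
  hence "pi * Re s / 4 * exp v \<le> \<bar>sin (pi * Re s)\<bar> / 2 * exp v" by (intro mult_right_mono) auto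
  also have "\<dots> \<le> d"
    using norm_sin_ge_vertical[of "of_real pi * s"] by (simp add: d_def v_def abs_mult)
  finally have 1: "pi * Re s / 4 * exp v \<le> d" .
  have "v * exp v \<le> (1 + 2 * v) * sinh v" by (rule times_exp_le_sinh[OF v])
  also have "\<dots> \<le> (1 + 2 * v) * d"
  proof (rule mult_left_mono)
    have "sinh v = \<bar>sinh (pi * Im s)\<bar>" by (simp add: v_def abs_mult flip: sinh_real_abs)
    thus "sinh v \<le> d" using norm_sin_ge_sinh[of "of_real pi * s"] by (simp add: d_def)
  qed (use v in simp)
  finally have 2: "v * exp v \<le> (1 + 2 * v) * d" .
  have "0 < pi * Re s / 4 * exp v" using assms by simp
  hence d: "d > 0" using 1 by linarith
  have "cmod (of_real pi * s) \<le> pi * Re s + v"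
    using cmod_le[of s] assms(1) mult_left_mono[of "cmod s" "\<bar>Re s\<bar> + \<bar>Im s\<bar>" pi]
    by (simp add: norm_mult v_def algebra_simps)
  hence "cmod (of_real pi * s) * exp v \<le> (pi * Re s + v) * exp v" by (intro mult_right_mono) auto
  also have "\<dots> \<le> 4 * d + (1 + 2 * v) * d" using 1 2 by (simp add: algebra_simps)
  also have "\<dots> = (5 + 2 * v) * d" by (simp add: algebra_simps)
  finally have "cmod (of_real pi * s) / d \<le> (5 + 2 * v) * exp (- v)"
    using d by (simp add: exp_minus field_simps)
  thus ?thesis by (simp add: norm_divide d_def v_def mult.assoc)
qed

text \<open>What is left of the kernel, apart from a factor \<open>1 / s\<close>, when the exponent of the saddle
  point is split off; \<open>\<phi>\<close> is the argument of \<open>z\<close>. Keeping \<open>exp (\<i> \<phi> s)\<close> here leaves a saddle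
  point that depends on \<open>\<bar>z\<bar>\<close> only and is real.\<close>
definition twisted_cosecant :: "real \<Rightarrow> complex \<Rightarrow> complex" where
  "twisted_cosecant \<phi> s = of_real pi * s / sin (of_real pi * s) * exp (\<i> * of_real \<phi> * s)"

text \<open>Half of the decay rate \<open>\<delta>\<close> is given up to absorb the linear factor.\<close>
lemma norm_twisted_cosecant_le:
  assumes "0 < Re s" "Re s \<le> 1/3" "\<delta> > 0" "\<bar>\<phi>\<bar> \<le> pi - \<delta>"
  shows "cmod (twisted_cosecant \<phi> s) \<le> (5 + 4 * pi / \<delta>) * exp (- (\<delta> / 2) * \<bar>Im s\<bar>)"
proof -
  define t where "t = \<bar>Im s\<bar>"
  have t: "t \<ge> 0" by (simp add: t_def)
  have "- (\<phi> * Im s) \<le> \<bar>\<phi>\<bar> * t" unfolding t_def by (metis abs_ge_minus_self abs_mult)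
  also have "\<dots> \<le> (pi - \<delta>) * t" using assms t by (intro mult_right_mono) auto
  finally have "cmod (exp (\<i> * of_real \<phi> * s)) \<le> exp ((pi - \<delta>) * t)" by simp
  hence "cmod (twisted_cosecant \<phi> s) \<le> ((5 + 2 * pi * t) * exp (- pi * t)) * exp ((pi - \<delta>) * t)"
    unfolding twisted_cosecant_def norm_mult[of "_ / _"]
    using norm_cosecant_kernel_le[OF assms(1,2)] t unfolding t_def[symmetric]
    by (intro mult_mono) auto
  also have "\<dots> = (5 + 2 * pi * t) * exp (- \<delta> * t)"
    by (simp add: algebra_simps flip: exp_add)
  also have "\<dots> = ((5 + 2 * pi * t) * exp (- (\<delta> / 2) * t)) * exp (- (\<delta> / 2) * t)"
    by (simp add: mult.assoc flip: exp_add)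
  also have "\<dots> \<le> (5 + 4 * pi / \<delta>) * exp (- (\<delta> / 2) * t)"
  proof (rule mult_right_mono)
    (* Both 1 and p are at most exp p. *)
    define p where "p = \<delta> / 2 * t"
    have p: "p \<ge> 0" using assms(3) t by (simp add: p_def)
    have "5 + 2 * pi * t = 5 + 4 * pi / \<delta> * p" using assms(3) by (simp add: p_def)
    also have "\<dots> \<le> 5 * exp p + 4 * pi / \<delta> * exp p"
      using p assms(3) order_trans[OF _ exp_ge_add_one_self[of p], of p] by (intro add_mono mult_left_mono) auto
    finally have "(5 + 2 * pi * t) * exp (- p) \<le> (5 * exp p + 4 * pi / \<delta> * exp p) * exp (- p)"
      by (intro mult_right_mono) auto
    also have "\<dots> = 5 + 4 * pi / \<delta>" by (simp add: distrib_right mult.assoc flip: exp_add)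
    finally show "(5 + 2 * pi * t) * exp (- (\<delta> / 2) * t) \<le> 5 + 4 * pi / \<delta>" by (simp add: p_def)
  qed simp
  finally show ?thesis by (simp add: t_def)
qed

lemma exp_half_le_2: "exp (1 / 2 :: real) \<le> 2"
proof -
  have "exp (1/2 :: real) ^ 2 \<le> 2 ^ 2"
    using e_less_272 by (simp flip: exp_of_nat_mult)
  thus ?thesis by (rule power2_le_imp_le) simp
qed

lemma twisted_cosecant_near_0:
  assumes "s \<noteq> 0" "pi * cmod s \<le> 1/2" "\<bar>\<phi>\<bar> \<le> pi"
  shows "cmod (twisted_cosecant \<phi> s - 1) \<le> 4 * pi * cmod s"
proof -
  define w where "w = of_real pi * s"
  define r where "r = cmod w"
  have r: "0 < r" "r \<le> 1/2" using assms by (auto simp: r_def w_def norm_mult)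
  have "cmod (sin w - (\<Sum>k\<le>2. complex_of_real (sin_coeff k) * w ^ k)) \<le> exp \<bar>Im w\<bar> * r ^ Suc 2 / fact 2"
    unfolding r_def by (rule Taylor_sin)
  also have "(\<Sum>k\<le>2. complex_of_real (sin_coeff k) * w ^ k) = w"
    by (simp add: eval_nat_numeral sin_coeff_def)
  also have "exp \<bar>Im w\<bar> * r ^ Suc 2 / fact 2 \<le> 2 * r ^ 3 / 2"
  proof -
    have "exp \<bar>Im w\<bar> \<le> exp (1/2)" using abs_Im_le_cmod[of w] r by (simp add: r_def)
    hence "exp \<bar>Im w\<bar> \<le> 2" using exp_half_le_2 by linarith
    thus ?thesis using r by (simp add: eval_nat_numeral mult_right_mono)
  qed
  also have "2 * r ^ 3 / 2 = r * r * r" by (simp add: eval_nat_numeral)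
  also have "\<dots> \<le> r * r * (1/2)" using r by (intro mult_left_mono) auto
  finally have sw: "cmod (sin w - w) \<le> r * r * (1/2)" .
  also have "\<dots> \<le> r * (1/2) * (1/2)" using r by (intro mult_right_mono mult_left_mono) auto
  finally have "cmod (sin w - w) \<le> r / 4" by simp
  hence sg: "cmod (sin w) \<ge> 3 * r / 4"
    using norm_triangle_ineq2[of w "sin w"] by (simp add: r_def norm_minus_commute)
  hence ne: "sin w \<noteq> 0" using r by auto
  have "w / sin w - 1 = (w - sin w) / sin w" using ne by (simp add: field_simps)
  hence "cmod (w / sin w - 1) = cmod (sin w - w) / cmod (sin w)"
    by (simp add: norm_divide norm_minus_commute)
  also have "\<dots> \<le> (r * r * (1/2)) / (3 * r / 4)" using sw sg r by (intro frac_le) auto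
  also have "\<dots> \<le> r" using r by simp
  finally have 1: "cmod (w / sin w - 1) \<le> r" .
  have 2: "cmod (w / sin w) \<le> 3 / 2"
    using norm_triangle_ineq[of "w / sin w - 1" 1] 1 r by simp
  have ps: "cmod (\<i> * of_real \<phi> * s) \<le> r"
    using assms(3) by (auto simp: r_def w_def norm_mult intro!: mult_right_mono)
  have "cmod (exp (\<i> * of_real \<phi> * s) - exp 0) \<le> exp (1/2) * cmod (\<i> * of_real \<phi> * s - 0)"
    using ps r complex_Re_le_cmod[of "\<i> * of_real \<phi> * s"] by (intro norm_exp_diff_le) auto
  also have "\<dots> \<le> 2 * r" using ps exp_half_le_2 by (intro mult_mono) auto
  finally have 3: "cmod (exp (\<i> * of_real \<phi> * s) - 1) \<le> 2 * r" by simp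
  have "twisted_cosecant \<phi> s - 1 = (w / sin w) * (exp (\<i> * of_real \<phi> * s) - 1) + (w / sin w - 1)"
    unfolding twisted_cosecant_def w_def[symmetric] by (simp add: right_diff_distrib)
  hence "cmod (twisted_cosecant \<phi> s - 1) \<le> cmod ((w / sin w) * (exp (\<i> * of_real \<phi> * s) - 1)) + cmod (w / sin w - 1)"
    by (simp only: norm_triangle_ineq)
  also have "\<dots> \<le> 3 / 2 * (2 * r) + r"
    unfolding norm_mult using 1 2 3 by (intro add_mono mult_mono) auto
  also have "\<dots> = 4 * pi * cmod s" by (simp add: r_def w_def norm_mult)
  finally show ?thesis .
qed

section \<open>The saddle point estimate\<close>
lemma lindelof_integral_saddle:
  assumes "c > 0" "a > 0" "\<sigma> > 0" "z \<noteq> 0"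
    and l: "ln (cmod z) = a * c * \<sigma> powr (- a - 1)"
  defines "N \<equiv> a * c * \<sigma> powr (- a)"
  shows "lindelof_integral c a \<sigma> z = of_real (exp (N * (1 + 1 / a))) *
    (LINT y|lborel. exp (of_real N * saddle_exponent a y) *
       twisted_cosecant (Im (Ln z)) (of_real \<sigma> * (1 + \<i> * of_real y)) / (1 + \<i> * of_real y))"
proof -
  let ?\<phi> = "Im (Ln z)"
  let ?D = "\<lambda>y. exp (of_real N * saddle_exponent a y) *
       twisted_cosecant ?\<phi> (of_real \<sigma> * (1 + \<i> * of_real y)) / (1 + \<i> * of_real y)"
  have Nl: "\<sigma> * ln (cmod z) = N"
  proof -
    have "\<sigma> powr (- a) = \<sigma> * \<sigma> powr (- a - 1)"
      using assms(3) powr_add[of \<sigma> 1 "- a - 1"] by simp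
    thus ?thesis by (simp add: l N_def)
  qed
  have pt: "\<sigma> *\<^sub>R lindelof_kernel c a z (Complex \<sigma> (0 + \<sigma> * y)) = of_real (exp (N * (1 + 1 / a))) * ?D y" for y
  proof -
    define u where "u = 1 + \<i> * complex_of_real y"
    define s where "s = of_real \<sigma> * u"
    have s: "Complex \<sigma> (0 + \<sigma> * y) = s" by (simp add: s_def u_def complex_eq_iff)
    have une: "u \<noteq> 0" by (simp add: u_def complex_eq_iff)
    have "s powr of_real (- a) = of_real (\<sigma> powr (- a)) * u powr of_real (- a)"
      unfolding s_def using assms(3) powr_of_real[of \<sigma> "- a"]
      by (subst powr_times_real_left) auto
    hence 1: "of_real c * s powr of_real (- a) = of_real N * (u powr of_real (- a) / of_real a)"
      using assms(2) by (simp add: N_def)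
    have "Ln z = of_real (ln (cmod z)) + \<i> * of_real ?\<phi>"
      using assms(4) by (simp add: complex_eq_iff)
    from arg_cong[OF this, of "\<lambda>x. s * x"]
    have "s * Ln z = of_real (\<sigma> * ln (cmod z)) * u + \<i> * of_real ?\<phi> * s"
      by (simp only: s_def distrib_left of_real_mult mult_ac)
    hence 2: "s * Ln z = of_real N * u + \<i> * of_real ?\<phi> * s" unfolding Nl .
    have 3: "of_real N * (u powr of_real (- a) / of_real a) + (of_real N * u + \<i> * of_real ?\<phi> * s)
        = of_real (N * (1 + 1 / a)) + (of_real N * saddle_exponent a y + \<i> * of_real ?\<phi> * s)"
      using assms(2) unfolding saddle_exponent_def u_def[symmetric]
      by (simp add: u_def field_simps)
    have 4: "of_real \<sigma> * (of_real pi / sin (of_real pi * s)) = of_real pi * s / sin (of_real pi * s) / u"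
      using une by (simp add: s_def)
    have "\<sigma> *\<^sub>R lindelof_kernel c a z s = of_real \<sigma> * (of_real pi / sin (of_real pi * s)) *
        exp (of_real c * s powr of_real (- a) + s * Ln z)"
      by (simp add: lindelof_kernel_def scaleR_conv_of_real exp_add)
    also have "\<dots> = of_real pi * s / sin (of_real pi * s) / u *
        exp (of_real (N * (1 + 1 / a)) + (of_real N * saddle_exponent a y + \<i> * of_real ?\<phi> * s))"
      unfolding 4 1 2 3 ..
    also have "\<dots> = of_real (exp (N * (1 + 1 / a))) * (exp (of_real N * saddle_exponent a y) * twisted_cosecant ?\<phi> s / u)"
      by (simp only: exp_add exp_of_real twisted_cosecant_def times_divide_eq_left times_divide_eq_right mult_ac)
    finally show ?thesis unfolding s by (simp only: s_def u_def)
  qed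
  have "lindelof_integral c a \<sigma> z = \<bar>\<sigma>\<bar> *\<^sub>R (LINT y|lborel. lindelof_kernel c a z (Complex \<sigma> (0 + \<sigma> * y)))"
    unfolding lindelof_integral_def using assms(3) by (intro lborel_integral_real_affine) auto
  also have "\<dots> = (LINT y|lborel. \<sigma> *\<^sub>R lindelof_kernel c a z (Complex \<sigma> (0 + \<sigma> * y)))"
    using assms(3) by simp
  also have "\<dots> = (LINT y|lborel. of_real (exp (N * (1 + 1 / a))) * ?D y)"
    unfolding pt ..
  also have "\<dots> = of_real (exp (N * (1 + 1 / a))) * (LINT y|lborel. ?D y)"
    by (rule Bochner_Integration.integral_mult_right_zero)
  finally show ?thesis .
qed

text \<open>The line \<open>Re s = \<sigma>\<close> is tied to \<open>z\<close> by the saddle point equation. Taking \<open>\<sigma>\<close> at most \<open>1/20\<close>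
  keeps the disc \<open>\<bar>s\<bar> \<le> 2 \<sigma>\<close> inside the range where \<^const>\<open>twisted_cosecant\<close> is expanded at 0.\<close>
lemma E_fun_saddle_estimate:
  assumes "c > 0" "a > 0" "\<delta> > 0"
  shows "\<exists>C. \<forall>\<sigma> z. 0 < \<sigma> \<longrightarrow> \<sigma> \<le> 1/20 \<longrightarrow> z \<noteq> 0 \<longrightarrow> \<bar>Im (Ln z)\<bar> \<le> pi - \<delta> \<longrightarrow>
     ln (cmod z) = a * c * \<sigma> powr (- a - 1) \<longrightarrow>
     (let N = a * c * \<sigma> powr (- a) in
        \<exists>\<rho>. cmod \<rho> \<le> C * (1 / sqrt N + \<sigma> + sqrt N * exp (- N / (4 + a)) / \<sigma>) \<and>
            E_fun c (- a) z = - of_real (exp (N * (1 + 1 / a)) / sqrt (2 * pi * N * (a + 1))) * (1 + \<rho>))"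
proof -
  define B where "B = (5 + 4 * pi / \<delta>) + 8 * pi"
  have B: "B \<ge> 0" "B \<ge> 8 * pi" "B \<ge> 5 + 4 * pi / \<delta>" using assms(3) by (auto simp: B_def)
  have d2: "\<delta> / 2 > 0" using assms(3) by simp
  obtain C where C: "\<And>N \<sigma> w. N > 0 \<Longrightarrow> \<sigma> > 0 \<Longrightarrow> continuous_on UNIV w \<Longrightarrow>
     (\<And>y. cmod (w y) \<le> B * exp (- (\<delta> / 2) * \<sigma> * \<bar>y\<bar>)) \<Longrightarrow>
     (\<And>y. \<bar>y\<bar> \<le> 1 \<Longrightarrow> cmod (w y - 1) \<le> B * \<sigma>) \<Longrightarrow>
     cmod ((LINT y|lborel. exp (of_real N * saddle_exponent a y) * w y / (1 + \<i> * of_real y))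
        - of_real (sqrt (2 * pi / (N * (a + 1)))))
     \<le> C * (1 / N + \<sigma> / sqrt N + exp (- N / (4 + a)) / \<sigma>)"
    using laplace_estimate[OF assms(2) B(1) d2] by blast
  define s0 where "s0 = sqrt (2 * pi / (a + 1))"
  have s0: "s0 > 0" using assms(2) by (simp add: s0_def)
  have "\<exists>\<rho>. cmod \<rho> \<le> C / s0 * (1 / sqrt N + \<sigma> + sqrt N * exp (- N / (4 + a)) / \<sigma>) \<and>
            E_fun c (- a) z = - of_real (exp (N * (1 + 1 / a)) / sqrt (2 * pi * N * (a + 1))) * (1 + \<rho>)"
    if sg: "0 < \<sigma>" "\<sigma> \<le> 1/20" and z: "z \<noteq> 0" "\<bar>Im (Ln z)\<bar> \<le> pi - \<delta>"
      and l: "ln (cmod z) = a * c * \<sigma> powr (- a - 1)" and Ndef: "N = a * c * \<sigma> powr (- a)" for \<sigma> z N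
  proof -
    have N: "N > 0" using assms sg by (simp add: Ndef)
    define w where "w y = twisted_cosecant (Im (Ln z)) (of_real \<sigma> * (1 + \<i> * of_real y))" for y
    define I where "I = (LINT y|lborel. exp (of_real N * saddle_exponent a y) * w y / (1 + \<i> * of_real y))"
    define S where "S = sqrt (2 * pi / (N * (a + 1)))"
    have S: "S = s0 / sqrt N" "S > 0" using N assms(2) by (auto simp: S_def s0_def real_sqrt_divide real_sqrt_mult)
    have rs: "Re (of_real \<sigma> * (1 + \<i> * of_real y)) = \<sigma>" "Im (of_real \<sigma> * (1 + \<i> * of_real y)) = \<sigma> * y" for y
      by simp_all
    have "sin (of_real pi * (of_real \<sigma> * (1 + \<i> * of_real y))) \<noteq> 0" for y
      using sg by (intro sin_pi_nonzero) (auto elim!: Ints_cases simp: complex_eq_iff)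
    hence wc: "continuous_on UNIV w"
      unfolding w_def twisted_cosecant_def by (intro continuous_intros) auto
    have w1: "cmod (w y) \<le> B * exp (- (\<delta> / 2) * \<sigma> * \<bar>y\<bar>)" for y
    proof -
      have "cmod (w y) \<le> (5 + 4 * pi / \<delta>) * exp (- (\<delta> / 2) * \<bar>Im (of_real \<sigma> * (1 + \<i> * of_real y))\<bar>)"
        unfolding w_def by (intro norm_twisted_cosecant_le) (use sg assms(3) z(2) rs in auto)
      also have "\<dots> \<le> B * exp (- (\<delta> / 2) * \<bar>Im (of_real \<sigma> * (1 + \<i> * of_real y))\<bar>)"
        using B by (intro mult_right_mono) auto
      finally show ?thesis using sg by (simp add: rs abs_mult mult.assoc)
    qed
    have w2: "cmod (w y - 1) \<le> B * \<sigma>" if y: "\<bar>y\<bar> \<le> 1" for y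
    proof -
      let ?s = "of_real \<sigma> * (1 + \<i> * of_real y)"
      have "cmod (1 + \<i> * of_real y) \<le> 2"
        using norm_triangle_ineq[of 1 "\<i> * complex_of_real y"] y by (simp add: norm_mult)
      hence cs: "cmod ?s \<le> \<sigma> * 2" using sg by (simp add: norm_mult)
      have "pi * cmod ?s \<le> 4 * (1/20 * 2)"
        using cs sg pi_less_4 by (intro mult_mono) auto
      hence "pi * cmod ?s \<le> 1/2" by simp
      hence "cmod (w y - 1) \<le> 4 * pi * cmod ?s"
        unfolding w_def using sg z(2) assms(3)
        by (intro twisted_cosecant_near_0) (auto simp: complex_eq_iff)
      also have "\<dots> \<le> 4 * pi * (\<sigma> * 2)" using cs by (intro mult_left_mono) auto
      also have "\<dots> \<le> B * \<sigma>" using B(2) sg by simp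
      finally show ?thesis .
    qed
    define \<rho> where "\<rho> = I / of_real S - 1"
    have "\<rho> = (I - of_real S) / of_real S" using S(2) by (simp add: \<rho>_def diff_divide_distrib)
    hence "cmod \<rho> = cmod (I - of_real S) / S" using S(2) by (simp add: norm_divide)
    also have "\<dots> \<le> C * (1 / N + \<sigma> / sqrt N + exp (- N / (4 + a)) / \<sigma>) / S"
      unfolding I_def S_def using S(2) C[OF N sg(1) wc w1 w2] unfolding S_def
      by (intro divide_right_mono) auto
    also have "\<dots> = C / s0 * (sqrt N / N + \<sigma> + sqrt N * exp (- N / (4 + a)) / \<sigma>)"
      using N s0 sg by (simp add: S(1) field_simps)
    also have "sqrt N / N = 1 / sqrt N" using N by (simp add: field_simps)
    finally have 1: "cmod \<rho> \<le> C / s0 * (1 / sqrt N + \<sigma> + sqrt N * exp (- N / (4 + a)) / \<sigma>)" .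
    have nr: "z \<notin> \<real>\<^sub>\<le>\<^sub>0"
    proof
      assume "z \<in> \<real>\<^sub>\<le>\<^sub>0"
      hence "Im (Ln z) = pi" using z(1) Im_Ln_eq_pi[of z] by (auto simp: complex_nonpos_Reals_iff complex_eq_iff)
      thus False using z(2) assms(3) by simp
    qed
    have "I = of_real S * (1 + \<rho>)" using S(2) by (simp add: \<rho>_def)
    hence "E_fun c (- a) z = - (of_real (exp (N * (1 + 1 / a))) * (of_real S * (1 + \<rho>))) / (2 * of_real pi)"
      using E_fun_eq_lindelof_integral[OF assms(1,2) sg(1) _ nr] sg
        lindelof_integral_saddle[OF assms(1,2) sg(1) z(1) l] unfolding Ndef[symmetric] w_def[symmetric] I_def[symmetric]
      by simp
    also have "\<dots> = - of_real (exp (N * (1 + 1 / a)) * (S / (2 * pi))) * (1 + \<rho>)"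
      by simp
    also have "S / (2 * pi) = 1 / sqrt (2 * pi * N * (a + 1))"
    proof -
      have "(S / (2 * pi)) = sqrt ((2 * pi / (N * (a + 1))) / (2 * pi)\<^sup>2)"
        unfolding S_def by (simp only: real_sqrt_divide real_sqrt_abs) simp
      also have "(2 * pi / (N * (a + 1))) / (2 * pi)\<^sup>2 = 1 / (2 * pi * N * (a + 1))"
        using N assms(2) by (simp add: power2_eq_square)
      finally show ?thesis by (simp add: real_sqrt_divide)
    qed
    finally have 2: "E_fun c (- a) z = - of_real (exp (N * (1 + 1 / a)) / sqrt (2 * pi * N * (a + 1))) * (1 + \<rho>)"
      by simp
    show ?thesis using 1 2 by blast
  qed
  thus ?thesis unfolding Let_def by (intro exI[of _ "C / s0"]) blast
qed

section \<open>The asymptotics in terms of the logarithm\<close>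

text \<open>Solving the saddle point equation gives \<open>\<sigma> = p l\<^sup>b\<^sup>-\<^sup>1\<close> and \<open>N = p l\<^sup>b\<close> with
  \<open>b = a / (1 + a)\<close> and \<open>p = (a c)\<close> to the power \<open>1 / (1 + a)\<close>, from which the constants
  \<^const>\<open>K1\<close> and \<^const>\<open>K2\<close> are read off.\<close>
lemma E_fun_log_modulus:
  assumes "c > 0" "a > 0" "\<delta> > 0"
  defines "m \<equiv> min (a / 2) 1 / (1 + a)"
  shows "\<exists>C X. \<forall>z. z \<noteq> 0 \<longrightarrow> \<bar>Im (Ln z)\<bar> \<le> pi - \<delta> \<longrightarrow> X \<le> ln (cmod z) \<longrightarrow>
     (\<exists>\<rho>. cmod \<rho> \<le> C * ln (cmod z) powr (- m) \<and>
        E_fun c (- a) z = - of_real (K1 c (- a) * ln (cmod z) powr (- a / (2 * (1 + a)))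
           * exp (K2 c (- a) * ln (cmod z) powr (a / (1 + a)))) * (1 + \<rho>))"
proof -
  define p where "p = (a * c) powr (1 / (1 + a))"
  define b where "b = a / (1 + a)"
  define k where "k = p / (4 + a)"
  have p: "p > 0" using assms by (simp add: p_def)
  have b: "b > 0" "b < 1" using assms by (auto simp: b_def)
  have k: "k > 0" using p assms(2) by (simp add: k_def)
  have b1: "1 / (1 + a) = 1 - b" using assms(2) by (simp add: b_def field_simps)
  have m: "m \<le> b / 2" "m \<le> 1 - b"
  proof -
    have "m \<le> (a / 2) / (1 + a)" "m \<le> 1 / (1 + a)"
      unfolding m_def using assms(2) by (intro divide_right_mono; simp)+
    moreover have "(a / 2) / (1 + a) = b / 2" by (simp add: b_def)
    ultimately show "m \<le> b / 2" "m \<le> 1 - b" unfolding b1 by linarith+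
  qed
  obtain C where C: "\<And>\<sigma> z N. 0 < \<sigma> \<Longrightarrow> \<sigma> \<le> 1/20 \<Longrightarrow> z \<noteq> 0 \<Longrightarrow> \<bar>Im (Ln z)\<bar> \<le> pi - \<delta> \<Longrightarrow>
     ln (cmod z) = a * c * \<sigma> powr (- a - 1) \<Longrightarrow> N = a * c * \<sigma> powr (- a) \<Longrightarrow>
        \<exists>\<rho>. cmod \<rho> \<le> C * (1 / sqrt N + \<sigma> + sqrt N * exp (- N / (4 + a)) / \<sigma>) \<and>
            E_fun c (- a) z = - of_real (exp (N * (1 + 1 / a)) / sqrt (2 * pi * N * (a + 1))) * (1 + \<rho>)"
    using E_fun_saddle_estimate[OF assms(1-3)] unfolding Let_def by blast
  define f where "f l = 1 / sqrt (p * l powr b) + p * l powr (b - 1)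
      + sqrt (p * l powr b) * exp (- (p * l powr b) / (4 + a)) / (p * l powr (b - 1))" for l :: real
  (* The exponentially small part of the error is eventually below l powr (- m) as well. *)
  have "((\<lambda>l::real. l powr (b / 2 + 1 - b + m) * exp (- k * l powr b)) \<longlongrightarrow> 0) at_top"
    using b k by real_asymp
  hence "eventually (\<lambda>l::real. l powr (b / 2 + 1 - b + m) * exp (- k * l powr b) < 1) at_top"
    by (rule order_tendstoD) simp
  moreover have "((\<lambda>l::real. p * l powr (b - 1)) \<longlongrightarrow> 0) at_top"
    using b by real_asymp
  hence "eventually (\<lambda>l::real. p * l powr (b - 1) < 1 / 20) at_top"
    by (rule order_tendstoD) simp
  ultimately have "eventually (\<lambda>l::real. l \<ge> 1 \<and> l powr (b / 2 + 1 - b + m) * exp (- k * l powr b) < 1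
      \<and> p * l powr (b - 1) < 1 / 20) at_top"
    using eventually_ge_at_top[of 1] by eventually_elim auto
  then obtain X where X: "\<And>l. l \<ge> X \<Longrightarrow> l \<ge> 1"
    "\<And>l. l \<ge> X \<Longrightarrow> l powr (b / 2 + 1 - b + m) * exp (- k * l powr b) < 1"
    "\<And>l. l \<ge> X \<Longrightarrow> p * l powr (b - 1) < 1 / 20"
    unfolding eventually_at_top_linorder by blast
  define D where "D = 1 / sqrt p + p + 1 / sqrt p"
  have fD: "f l \<le> D * l powr (- m)" if "l \<ge> X" for l
  proof -
    have l: "l \<ge> 1" using X(1)[OF that] .
    have sq: "sqrt (p * l powr b) = sqrt p * l powr (b / 2)"
      using l by (simp add: real_sqrt_mult powr_half_sqrt_powr)
    have "1 / sqrt (p * l powr b) = 1 / sqrt p * l powr (- (b / 2))"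
      unfolding sq by (simp add: powr_minus_divide)
    also have "\<dots> \<le> 1 / sqrt p * l powr (- m)"
      using l m p by (intro mult_left_mono powr_mono) auto
    finally have 1: "1 / sqrt (p * l powr b) \<le> 1 / sqrt p * l powr (- m)" .
    have 2: "p * l powr (b - 1) \<le> p * l powr (- m)"
      using l m p by (intro mult_left_mono powr_mono) auto
    have "sqrt (p * l powr b) * exp (- (p * l powr b) / (4 + a)) / (p * l powr (b - 1))
        = 1 / sqrt p * ((l powr (b / 2) / l powr (b - 1)) * exp (- k * l powr b))"
    proof -
      have sp: "sqrt p / p = 1 / sqrt p" using p by (simp add: sqrt_divide_self_eq inverse_eq_divide)
      have "- (p * l powr b) / (4 + a) = - k * l powr b" by (simp add: k_def)
      hence "sqrt p * l powr (b / 2) * exp (- (p * l powr b) / (4 + a)) / (p * l powr (b - 1))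
          = (sqrt p / p) * ((l powr (b / 2) / l powr (b - 1)) * exp (- k * l powr b))"
        by simp
      thus ?thesis unfolding sq sp .
    qed
    also have "l powr (b / 2) / l powr (b - 1) = l powr (b / 2 + 1 - b + m) * l powr (- m)"
      by (simp add: algebra_simps flip: powr_diff powr_add)
    also have "1 / sqrt p * (l powr (b / 2 + 1 - b + m) * l powr (- m) * exp (- k * l powr b))
        = 1 / sqrt p * (l powr (b / 2 + 1 - b + m) * exp (- k * l powr b)) * l powr (- m)"
      by (simp only: mult_ac)
    also have "\<dots> \<le> 1 / sqrt p * 1 * l powr (- m)"
      using X(2)[OF that] p by (intro mult_right_mono mult_left_mono) auto
    finally have 3: "sqrt (p * l powr b) * exp (- (p * l powr b) / (4 + a)) / (p * l powr (b - 1))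
        \<le> 1 / sqrt p * l powr (- m)" by simp
    show ?thesis using 1 2 3 by (simp add: f_def D_def algebra_simps)
  qed
  have "\<exists>\<rho>. cmod \<rho> \<le> \<bar>C\<bar> * D * ln (cmod z) powr (- m) \<and>
        E_fun c (- a) z = - of_real (K1 c (- a) * ln (cmod z) powr (- a / (2 * (1 + a)))
           * exp (K2 c (- a) * ln (cmod z) powr (a / (1 + a)))) * (1 + \<rho>)"
    if z: "z \<noteq> 0" "\<bar>Im (Ln z)\<bar> \<le> pi - \<delta>" "X \<le> ln (cmod z)" for z
  proof -
    define l where "l = ln (cmod z)"
    have l: "l \<ge> 1" using X(1) z(3) by (simp add: l_def)
    define \<sigma> where "\<sigma> = p * l powr (b - 1)"
    define N where "N = p * l powr b"
    have sg: "0 < \<sigma>" "\<sigma> \<le> 1/20" using p l X(3)[of l] z(3) by (auto simp: \<sigma>_def l_def)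
    have acp: "a * c = p powr (1 + a)" using assms by (simp add: p_def powr_powr)
    have e1: "(b - 1) * (- a - 1) = 1" "(b - 1) * (- a) = b"
      using assms(2) by (simp_all add: b_def field_simps)
    have "a * c * \<sigma> powr (- a - 1) = l"
      unfolding \<sigma>_def acp using p l e1 by (simp add: powr_mult powr_powr flip: powr_add)
    hence h1: "ln (cmod z) = a * c * \<sigma> powr (- a - 1)" by (simp add: l_def)
    have h2: "N = a * c * \<sigma> powr (- a)"
      unfolding \<sigma>_def acp N_def using p l e1
      by (simp add: powr_mult powr_powr mult.assoc[symmetric] flip: powr_add)
    obtain \<rho> where r: "cmod \<rho> \<le> C * (1 / sqrt N + \<sigma> + sqrt N * exp (- N / (4 + a)) / \<sigma>)"
      "E_fun c (- a) z = - of_real (exp (N * (1 + 1 / a)) / sqrt (2 * pi * N * (a + 1))) * (1 + \<rho>)"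
      using C[OF sg z(1,2) h1 h2] by blast
    have fl: "1 / sqrt N + \<sigma> + sqrt N * exp (- N / (4 + a)) / \<sigma> = f l"
      by (simp add: f_def N_def \<sigma>_def)
    have f0: "f l \<ge> 0" unfolding f_def using p by (intro add_nonneg_nonneg) auto
    have "cmod \<rho> \<le> C * f l" using r(1) unfolding fl .
    also have "\<dots> \<le> \<bar>C\<bar> * f l" using f0 by (intro mult_right_mono) auto
    also have "\<dots> \<le> \<bar>C\<bar> * (D * l powr (- m))"
      using fD[of l] z(3) by (intro mult_left_mono) (auto simp: l_def)
    finally have r1: "cmod \<rho> \<le> \<bar>C\<bar> * D * l powr (- m)" by simp
    have K2e: "N * (1 + 1 / a) = K2 c (- a) * l powr b"
      by (simp add: N_def K2_def p_def mult_ac)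
    have K1e: "1 / sqrt (2 * pi * N * (a + 1)) = K1 c (- a) * l powr (- a / (2 * (1 + a)))"
    proof -
      have "1 / sqrt (2 * pi * N * (a + 1)) = (2 * pi * (1 + a) * N) powr (- 1 / 2)"
        using l p assms(2) by (simp add: N_def powr_minus_divide powr_half_sqrt mult_ac add.commute)
      also have "\<dots> = (2 * pi * (1 + a)) powr (- 1 / 2) * (p powr (- 1 / 2) * (l powr b) powr (- 1 / 2))"
        unfolding N_def using l p assms(2) by (simp only: powr_mult)
      also have "p powr (- 1 / 2) = (a * c) powr (1 / (2 * (- a - 1)))"
      proof -
        have "1 / (1 + a) * (- 1 / 2) = 1 / (2 * (- a - 1))" using assms(2) by (simp add: field_simps)
        thus ?thesis unfolding p_def powr_powr by (rule arg_cong)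
      qed
      also have "(l powr b) powr (- 1 / 2) = l powr (- a / (2 * (1 + a)))"
      proof -
        have "b * (- 1 / 2) = - a / (2 * (1 + a))" by (simp add: b_def)
        thus ?thesis unfolding powr_powr by (rule arg_cong)
      qed
      finally show ?thesis by (simp add: K1_def mult_ac)
    qed
    have "exp (N * (1 + 1 / a)) / sqrt (2 * pi * N * (a + 1))
        = (1 / sqrt (2 * pi * N * (a + 1))) * exp (N * (1 + 1 / a))" by simp
    also have "\<dots> = K1 c (- a) * l powr (- a / (2 * (1 + a))) * exp (K2 c (- a) * l powr (a / (1 + a)))"
      unfolding K1e K2e b_def ..
    finally show ?thesis using r(2) r1 unfolding l_def by metis
  qed
  thus ?thesis by blast
qed

text \<open>The main term is the exponential of a function \<open>\<Phi>\<close> whose derivative on the half-plane to the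
  right of \<open>Re L\<close> is at most of order \<open>Re L\<close> to the power \<open>- 1 / (1 + a)\<close>; moving from \<open>L\<close> to its real
  part changes \<open>\<Phi>\<close> by at most \<open>\<pi>\<close> times that.\<close>
lemma main_term_log_modulus_vs_log:
  fixes a \<kappa> :: real and L :: complex
  assumes "a > 0" "\<kappa> > 0" "1 \<le> Re L" "\<bar>Im L\<bar> \<le> pi"
  defines "b \<equiv> a / (1 + a)" and "Q \<equiv> pi * (a / (1 + a) / 2 + \<kappa> * (a / (1 + a)))"
  shows "\<exists>w. cmod w \<le> Q * Re L powr (- 1 / (1 + a)) \<and>
    of_real (Re L powr (- a / (2 * (1 + a))) * exp (\<kappa> * Re L powr b))
     = L powr of_real (- a / (2 * (1 + a))) * exp (of_real \<kappa> * L powr of_real b) * exp w"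
proof -
  define l where "l = Re L"
  define \<Phi> where "\<Phi> s = of_real (- (b / 2)) * Ln s + of_real \<kappa> * s powr of_real b" for s
  let ?S = "{s. l \<le> Re s}"
  have b: "b > 0" "b < 1" using assms(1) by (auto simp: b_def)
  have b1: "- 1 / (1 + a) = b - 1" using assms(1) by (simp add: b_def field_simps)
  have b2: "- a / (2 * (1 + a)) = - (b / 2)" by (simp add: b_def)
  have l: "l \<ge> 1" using assms(3) by (simp add: l_def)
  have "cmod (\<Phi> (of_real l) - \<Phi> L) \<le> ((b / 2 + \<kappa> * b) * l powr (b - 1)) * cmod (of_real l - L)"
  proof (rule field_differentiable_bound[where S = ?S])
    show "convex ?S" by (rule convex_halfspace_Re_ge)
    fix s assume s: "s \<in> ?S"
    have nr: "s \<notin> \<real>\<^sub>\<le>\<^sub>0" using s l by (auto simp: complex_nonpos_Reals_iff)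
    have ls: "l \<le> cmod s" using s complex_Re_le_cmod[of s] by simp
    show "(\<Phi> has_field_derivative (of_real (- (b / 2)) * inverse s + of_real \<kappa> * (of_real b * s powr (of_real b - 1)))) (at s within ?S)"
      unfolding \<Phi>_def
      by (rule has_field_derivative_at_within, intro DERIV_add DERIV_cmult has_field_derivative_Ln has_field_derivative_powr nr)
    have "cmod (s powr (of_real b - 1)) = cmod s powr (b - 1)"
      using norm_powr_real_powr'[of "of_real (b - 1)" s] by simp
    also have "\<dots> \<le> l powr (b - 1)" using b l ls by (intro powr_mono2') auto
    finally have 1: "cmod (s powr (of_real b - 1)) \<le> l powr (b - 1)" .
    have "cmod (inverse s) \<le> inverse l"
      unfolding norm_inverse using ls l by (intro le_imp_inverse_le) auto
    also have "\<dots> = l powr (- 1)" using l by (simp add: powr_minus)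
    also have "\<dots> \<le> l powr (b - 1)" using b l by (intro powr_mono) auto
    finally have 2: "cmod (inverse s) \<le> l powr (b - 1)" .
    have "cmod (of_real (- (b / 2)) * inverse s + of_real \<kappa> * (of_real b * s powr (of_real b - 1)))
        \<le> b / 2 * cmod (inverse s) + \<kappa> * (b * cmod (s powr (of_real b - 1)))"
      using norm_triangle_ineq[of "of_real (- (b / 2)) * inverse s" "of_real \<kappa> * (of_real b * s powr (of_real b - 1))"] b assms(2)
      by (simp add: norm_mult)
    also have "\<dots> \<le> b / 2 * l powr (b - 1) + \<kappa> * (b * l powr (b - 1))"
      using b assms(2) by (intro add_mono mult_left_mono 1 2) auto
    also have "\<dots> = (b / 2 + \<kappa> * b) * l powr (b - 1)" by (simp add: algebra_simps)
    finally show "cmod (of_real (- (b / 2)) * inverse s + of_real \<kappa> * (of_real b * s powr (of_real b - 1)))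
        \<le> (b / 2 + \<kappa> * b) * l powr (b - 1)" .
  qed (auto simp: l_def)
  also have "cmod (of_real l - L) = \<bar>Im L\<bar>"
  proof -
    have "of_real l - L = \<i> * of_real (- Im L)" by (simp add: l_def complex_eq_iff)
    thus ?thesis by (simp only: norm_mult norm_of_real) simp
  qed
  also have "((b / 2 + \<kappa> * b) * l powr (b - 1)) * \<bar>Im L\<bar> \<le> ((b / 2 + \<kappa> * b) * l powr (b - 1)) * pi"
    using b assms(2,4) by (intro mult_left_mono) auto
  also have "\<dots> = Q * l powr (- 1 / (1 + a))"
    unfolding b1 Q_def b_def[symmetric] by (simp only: mult_ac)
  finally have 1: "cmod (\<Phi> (of_real l) - \<Phi> L) \<le> Q * l powr (- 1 / (1 + a))" .
  have e: "exp (\<Phi> s) = s powr of_real (- (b / 2)) * exp (of_real \<kappa> * s powr of_real b)" if "s \<noteq> 0" for s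
    using that unfolding \<Phi>_def exp_add by (simp add: powr_def)
  have pr: "of_real l powr of_real x = complex_of_real (l powr x)" for x using l by (intro powr_of_real) auto
  have "complex_of_real (l powr (- (b / 2)) * exp (\<kappa> * l powr b))
      = of_real (l powr (- (b / 2))) * exp (of_real \<kappa> * of_real (l powr b))"
    by (simp only: of_real_mult exp_of_real[symmetric])
  also have "\<dots> = exp (\<Phi> (of_real l))"
    unfolding pr[symmetric] by (rule e[symmetric]) (use l in simp)
  also have "\<dots> = exp (\<Phi> L) * exp (\<Phi> (of_real l) - \<Phi> L)" by (simp flip: exp_add)
  also have "exp (\<Phi> L) = L powr of_real (- (b / 2)) * exp (of_real \<kappa> * L powr of_real b)"
    using l by (intro e) (auto simp: l_def)
  finally show ?thesis using 1 unfolding l_def b2 by blast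
qed

text \<open>The closed interval \<open>[\<alpha>, \<beta>]\<close> contains no odd multiple of \<open>\<pi>\<close>, so \<open>\<bar>arg\<bar>\<close> is continuous along
  the arc and attains its maximum, which is less than \<open>\<pi>\<close>. Working with \<open>cis\<close> avoids any
  normalisation of the angles, which may lie many turns away from the principal range.\<close>
lemma sector_argument_bound:
  assumes "sector \<alpha> \<beta> \<inter> complex_of_real ` {..<0} = {}"
  shows "\<exists>\<delta>>0. \<forall>z\<in>sector \<alpha> \<beta>. z \<noteq> 0 \<longrightarrow> \<bar>Im (Ln z)\<bar> \<le> pi - \<delta>"
proof (cases "\<alpha> \<le> \<beta>")
  case False
  hence "sector \<alpha> \<beta> = {}" by (auto simp: sector_def)
  thus ?thesis by (intro exI[of _ 1]) simp
next
  case True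
  have nr: "cis \<phi> \<notin> \<real>\<^sub>\<le>\<^sub>0" if "\<phi> \<in> {\<alpha>..\<beta>}" for \<phi>
  proof
    assume "cis \<phi> \<in> \<real>\<^sub>\<le>\<^sub>0"
    then obtain x where x: "cis \<phi> = of_real x" "x \<le> 0" by (auto elim: nonpos_Reals_cases)
    have "x \<noteq> 0" using x(1) by (auto simp: complex_eq_iff) (metis cis_neq_zero x(1) of_real_0)
    hence "cis \<phi> \<in> complex_of_real ` {..<0}" using x by auto
    moreover have "cis \<phi> \<in> sector \<alpha> \<beta>"
      using that unfolding sector_def by (intro CollectI exI[of _ 1] exI[of _ \<phi>]) (auto simp: rcis_def)
    ultimately show False using assms by blast
  qed
  have "continuous_on {\<alpha>..\<beta>} (\<lambda>\<phi>. \<bar>Im (Ln (cis \<phi>))\<bar>)"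
    by (intro continuous_intros nr)
  from continuous_attains_sup[OF compact_Icc _ this] True
  obtain \<phi>0 where p0: "\<phi>0 \<in> {\<alpha>..\<beta>}" "\<And>\<phi>. \<phi> \<in> {\<alpha>..\<beta>} \<Longrightarrow> \<bar>Im (Ln (cis \<phi>))\<bar> \<le> \<bar>Im (Ln (cis \<phi>0))\<bar>"
    by auto
  show ?thesis
  proof (intro exI[of _ "pi - \<bar>Im (Ln (cis \<phi>0))\<bar>"] conjI ballI impI)
    show "pi - \<bar>Im (Ln (cis \<phi>0))\<bar> > 0" using Im_Ln_lt_pi[OF nr[OF p0(1)]] by simp
    fix z assume "z \<in> sector \<alpha> \<beta>" "z \<noteq> 0"
    then obtain r \<phi> where z: "z = of_real r * cis \<phi>" "r > 0" "\<phi> \<in> {\<alpha>..\<beta>}"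
      by (auto simp: sector_def rcis_def less_le)
    have "Im (Ln z) = Im (Ln (cis \<phi>))"
      unfolding z(1) using z(2) by (subst Ln_times_of_real) auto
    thus "\<bar>Im (Ln z)\<bar> \<le> pi - (pi - \<bar>Im (Ln (cis \<phi>0))\<bar>)" using p0(2)[OF z(3)] by simp
  qed
qed

text \<open>The remainder \<open>R\<close> is defined by solving the claimed equation; only its size has to be estimated. It
  combines the error of the saddle point method with that of replacing \<open>ln \<bar>z\<bar>\<close> by the logarithm.\<close>
theorem theorem3:
  fixes c \<theta> \<epsilon> \<alpha> \<beta> :: real
  assumes "c > 0" and "\<theta> < 0" and "\<epsilon> > 0"
    and "sector \<alpha> \<beta> \<inter> complex_of_real ` {..<0} = {}"
  shows "K1 c \<theta> > 0 \<and> K2 c \<theta> > 0 \<and>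
         (\<exists>R :: complex \<Rightarrow> complex.
           R \<in> O[inf at_infinity (principal (sector \<alpha> \<beta>))](\<lambda>z. Ln z powr of_real (- mu \<theta> \<epsilon>)) \<and>
           (\<forall>\<^sub>F z in inf at_infinity (principal (sector \<alpha> \<beta>)).
              E_fun c \<theta> z =
                - of_real (K1 c \<theta>) * Ln z powr of_real (\<theta> / (2 * (1 - \<theta>)))
                  * exp (of_real (K2 c \<theta>) * Ln z powr of_real (\<theta> / (\<theta> - 1)))
                  * (1 + R z)))"
proof -
  define a where "a = - \<theta>"
  have a: "a > 0" using assms(2) by (simp add: a_def)
  have th: "- a = \<theta>" by (simp add: a_def)
  define m where "m = min (a / 2) 1 / (1 + a)"
  have ct: "- c * \<theta> > 0" using assms(1,2) by (simp add: mult_pos_neg)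
  have nz: "2 * pi * (1 - \<theta>) \<noteq> 0" "- c * \<theta> \<noteq> 0" using ct assms(2) by auto
  hence K1: "K1 c \<theta> > 0" unfolding K1_def by (simp only: powr_gt_zero mult_pos_pos not_False_eq_True)
  have K2: "K2 c \<theta> > 0"
  proof -
    have "1 / \<theta> < 0" using assms(2) by simp
    hence "1 - 1 / \<theta> > 0" by linarith
    moreover have "(- c * \<theta>) powr (1 / (1 - \<theta>)) > 0"
      using nz by (simp only: powr_gt_zero not_False_eq_True)
    ultimately show ?thesis unfolding K2_def by (rule mult_pos_pos)
  qed
  have m: "m > 0" "m \<le> 1 / (1 + a)"
    using a by (auto simp: m_def intro!: divide_right_mono)
  have mu: "mu \<theta> \<epsilon> \<le> m"
  proof (cases "\<theta> \<ge> - 2")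
    case True
    have "\<theta> / (2 * (\<theta> - 1)) = (a / 2) / (1 + a)" using a by (simp add: a_def field_simps)
    moreover have "m = (a / 2) / (1 + a)" using True by (simp add: m_def a_def min_def)
    ultimately show ?thesis using True assms(3) by (simp add: mu_def)
  next
    case False
    hence "m = 1 / (1 + a)" by (simp add: m_def a_def min_def)
    thus ?thesis using False by (simp add: mu_def a_def)
  qed
  have ex1: "\<theta> / (2 * (1 - \<theta>)) = - a / (2 * (1 + a))" by (simp add: a_def)
  have ex2: "\<theta> / (\<theta> - 1) = a / (1 + a)" using a by (simp add: a_def field_simps)
  obtain \<delta> where d: "\<delta> > 0" "\<And>z. z \<in> sector \<alpha> \<beta> \<Longrightarrow> z \<noteq> 0 \<Longrightarrow> \<bar>Im (Ln z)\<bar> \<le> pi - \<delta>"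
    using sector_argument_bound[OF assms(4)] by blast
  obtain C X where CX: "\<And>z. z \<noteq> 0 \<Longrightarrow> \<bar>Im (Ln z)\<bar> \<le> pi - \<delta> \<Longrightarrow> X \<le> ln (cmod z) \<Longrightarrow>
     (\<exists>\<rho>. cmod \<rho> \<le> C * ln (cmod z) powr (- m) \<and>
        E_fun c \<theta> z = - of_real (K1 c \<theta> * ln (cmod z) powr (- a / (2 * (1 + a)))
           * exp (K2 c \<theta> * ln (cmod z) powr (a / (1 + a)))) * (1 + \<rho>))"
    using E_fun_log_modulus[OF assms(1) a d(1)] unfolding m_def[symmetric] th by blast
  define Q where "Q = pi * (a / (1 + a) / 2 + K2 c \<theta> * (a / (1 + a)))"
  have Q: "Q \<ge> 0" using a K2 by (simp add: Q_def)
  define P where "P z = of_real (K1 c \<theta>) * Ln z powr of_real (\<theta> / (2 * (1 - \<theta>)))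
                  * exp (of_real (K2 c \<theta>) * Ln z powr of_real (\<theta> / (\<theta> - 1)))" for z
  define R where "R z = - E_fun c \<theta> z / P z - 1" for z
  define D where "D = exp Q * (Q + \<bar>C\<bar>) * (1 + pi) powr m"
  have main: "P z \<noteq> 0 \<and> cmod (R z) \<le> D * cmod (Ln z powr of_real (- mu \<theta> \<epsilon>))"
    if z: "z \<in> sector \<alpha> \<beta>" "exp (max X 1) \<le> cmod z" for z
  proof -
    have z0: "z \<noteq> 0" using z(2) by auto
    define L where "L = Ln z"
    define l where "l = ln (cmod z)"
    have lmax: "max X 1 \<le> l" 
      unfolding l_def using z(2) z0 ln_ge_iff[of "cmod z" "max X 1"] zero_less_norm_iff[of z] by blast
    have l: "l \<ge> 1" "l \<ge> X" using lmax by simp_all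
    have ReL: "Re L = l" using z0 by (simp add: L_def l_def)
    have ImL: "\<bar>Im L\<bar> \<le> pi - \<delta>" unfolding L_def by (rule d(2)[OF z(1) z0])
    have ImL': "\<bar>Im L\<bar> \<le> pi" using ImL d(1) by simp
    have L0: "L \<noteq> 0" using ReL l by auto
    have P0: "P z \<noteq> 0" using K1 L0 by (simp add: P_def L_def powr_def)
    obtain \<rho> where r: "cmod \<rho> \<le> C * l powr (- m)"
      "E_fun c \<theta> z = - of_real (K1 c \<theta> * l powr (- a / (2 * (1 + a))) * exp (K2 c \<theta> * l powr (a / (1 + a)))) * (1 + \<rho>)"
      using CX[OF z0] ImL l unfolding l_def L_def by blast
    have Re1: "1 \<le> Re L" using ReL l by simp
    obtain w where w: "cmod w \<le> Q * l powr (- 1 / (1 + a))"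
      "of_real (l powr (- a / (2 * (1 + a))) * exp (K2 c \<theta> * l powr (a / (1 + a))))
        = L powr of_real (- a / (2 * (1 + a))) * exp (of_real (K2 c \<theta>) * L powr of_real (a / (1 + a))) * exp w"
      using main_term_log_modulus_vs_log[OF a K2 Re1 ImL'] unfolding ReL Q_def[symmetric] by blast
    have "E_fun c \<theta> z = - (of_real (K1 c \<theta>) *
        of_real (l powr (- a / (2 * (1 + a))) * exp (K2 c \<theta> * l powr (a / (1 + a))))) * (1 + \<rho>)"
      unfolding r(2) by (simp only: of_real_mult mult.assoc)
    also have "\<dots> = - (P z * exp w) * (1 + \<rho>)"
      unfolding w(2) P_def ex1 ex2 L_def[symmetric] by (simp only: mult.assoc)
    finally have "R z = exp w * (1 + \<rho>) - 1" using P0 by (simp add: R_def)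
    hence "R z = (exp w - exp 0) + exp w * \<rho>" by (simp add: algebra_simps)
    hence "cmod (R z) \<le> cmod (exp w - exp 0) + cmod (exp w) * cmod \<rho>"
      by (simp only: norm_mult[symmetric] norm_triangle_ineq)
    also have "\<dots> \<le> exp Q * (Q * l powr (- m)) + exp Q * (\<bar>C\<bar> * l powr (- m))"
    proof (intro add_mono mult_mono)
      have wm: "cmod w \<le> Q * l powr (- m)"
        using w(1) Q l m mult_left_mono[of "l powr (- 1 / (1 + a))" "l powr (- m)" Q] powr_mono[of "- 1 / (1 + a)" "- m" l]
        by simp
      have "l powr (- m) \<le> 1" using l m powr_mono[of "- m" 0 l] by simp
      hence "Q * l powr (- m) \<le> Q * 1" using Q by (intro mult_left_mono) auto
      hence wQ: "cmod w \<le> Q" using wm by simp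
      have rw: "Re w \<le> Q" using wQ complex_Re_le_cmod[of w] by simp
      have "cmod (exp w - exp 0) \<le> exp Q * cmod (w - 0)"
        using rw Q by (intro norm_exp_diff_le) auto
      also have "\<dots> \<le> exp Q * (Q * l powr (- m))" using wm by (intro mult_left_mono) auto
      finally show "cmod (exp w - exp 0) \<le> exp Q * (Q * l powr (- m))" .
      show "cmod (exp w) \<le> exp Q" using rw by simp
      show "cmod \<rho> \<le> \<bar>C\<bar> * l powr (- m)"
        by (rule order_trans[OF r(1)]) (intro mult_right_mono, auto)
    qed auto
    also have "\<dots> = exp Q * (Q + \<bar>C\<bar>) * l powr (- m)" by (simp add: algebra_simps)
    also have "\<dots> \<le> exp Q * (Q + \<bar>C\<bar>) * ((1 + pi) powr m * cmod L powr (- mu \<theta> \<epsilon>))"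
    proof (rule mult_left_mono)
      have "cmod L \<le> l + pi" using cmod_le[of L] ReL ImL' l by simp
      also have "\<dots> \<le> (1 + pi) * l" using l by (simp add: distrib_right)
      finally have Ll: "cmod L \<le> (1 + pi) * l" .
      have L1: "cmod L \<ge> 1" using complex_Re_le_cmod[of L] Re1 by linarith
      have "l powr (- m) = (1 + pi) powr m * ((1 + pi) * l) powr (- m)"
      proof -
        have p1: "1 + pi > 0" using pi_gt_zero by linarith
        have "(1 + pi) powr m * (1 + pi) powr (- m) = 1" using p1 by (simp flip: powr_add)
        moreover have "((1 + pi) * l) powr (- m) = (1 + pi) powr (- m) * l powr (- m)"
          by (rule powr_mult)
        ultimately show ?thesis by (simp only: mult.assoc[symmetric] mult_1)
      qed
      also have "\<dots> \<le> (1 + pi) powr m * cmod L powr (- m)"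
        using Ll L1 m by (intro mult_left_mono powr_mono2') auto
      also have "\<dots> \<le> (1 + pi) powr m * cmod L powr (- mu \<theta> \<epsilon>)"
        using L1 mu by (intro mult_left_mono powr_mono) auto
      finally show "l powr (- m) \<le> (1 + pi) powr m * cmod L powr (- mu \<theta> \<epsilon>)" .
    qed (use Q in auto)
    also have "\<dots> = D * cmod (Ln z powr of_real (- mu \<theta> \<epsilon>))"
      by (simp only: D_def mult.assoc L_def[symmetric] norm_powr_real_powr'[OF Reals_of_real] Re_complex_of_real)
    finally show ?thesis using P0 by blast
  qed
  have ev: "eventually (\<lambda>z. P z \<noteq> 0 \<and> cmod (R z) \<le> D * cmod (Ln z powr of_real (- mu \<theta> \<epsilon>)))
      (inf at_infinity (principal (sector \<alpha> \<beta>)))"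
    unfolding eventually_inf_principal eventually_at_infinity using main by blast
  have "R \<in> O[inf at_infinity (principal (sector \<alpha> \<beta>))](\<lambda>z. Ln z powr of_real (- mu \<theta> \<epsilon>))"
    by (rule bigoI[of _ D], rule eventually_mono[OF ev]) auto
  moreover have "\<forall>\<^sub>F z in inf at_infinity (principal (sector \<alpha> \<beta>)).
              E_fun c \<theta> z =
                - of_real (K1 c \<theta>) * Ln z powr of_real (\<theta> / (2 * (1 - \<theta>)))
                  * exp (of_real (K2 c \<theta>) * Ln z powr of_real (\<theta> / (\<theta> - 1)))
                  * (1 + R z)"
  proof (rule eventually_mono[OF ev])
    fix z assume "P z \<noteq> 0 \<and> cmod (R z) \<le> D * cmod (Ln z powr of_real (- mu \<theta> \<epsilon>))"
    hence "E_fun c \<theta> z = - P z * (1 + R z)" by (simp add: R_def)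
    thus "E_fun c \<theta> z =
                - of_real (K1 c \<theta>) * Ln z powr of_real (\<theta> / (2 * (1 - \<theta>)))
                  * exp (of_real (K2 c \<theta>) * Ln z powr of_real (\<theta> / (\<theta> - 1)))
                  * (1 + R z)"
      by (simp only: P_def mult_minus_left)
  qed
  ultimately show ?thesis using K1 K2 by blast
qed

end
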